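(* Let $w$ be a nonnegative weight function on $[-1,1]$ and let $k_n(\cdot,\cdot):=k_n(w;\cdot,\cdot)$ be the one-variable reproducing kernel of $w$. Set $$u:=(u_1,u_2)=(x_1+x_2,\;x_1x_2)\quad\text{and}\quad v:=(v_1,v_2)=(y_1+y_2,\;y_1y_2).$$ Then the reproducing kernel $K_n^{(-\frac12)}(\cdot,\cdot)$ for $W_{-\frac12}$ is given by $$K_n^{(-\frac12)}(u,v)=\frac12\left[k_n(x_1,y_1)k_n(x_2,y_2)+k_n(x_2,y_1)k_n(x_1,y_2)\right],$$ and the reproducing kernel $K_n^{(\frac12)}(\cdot,\cdot)$ for $W_{\frac12}$ is given by $$K_n^{(\frac12)}(u,v)=\frac12\,\frac{k_{n+1}(x_1,y_1)k_{n+1}(x_2,y_2)-k_{n+1}(x_2,y_1)k_{n+1}(x_1,y_2)}{(x_1-x_2)(y_1-y_2)}.$$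
   Context: One variable: $w$ is a nonnegative weight function on $[-1,1]$ with finite moments of all orders; $p_n$ denotes the orthonormal polynomial of degree $n$ with positive leading coefficient, $\int_{-1}^1p_n(x)p_m(x)w(x)\,dx=\delta_{n,m}$, and $k_n(w;x,y)=\sum_{k=0}^n p_k(x)p_k(y)$ is the reproducing kernel of the polynomials of degree at most $n$ in $L^2(w)$. Two variables: $\Omega=\{(u,v):1+u+v>0,\;1-u+v>0,\;u^2>4v\}$. The map $(x,y)\mapsto(x+y,xy)$ is a bijection from $\{(x,y):-1<x<y<1\}$ onto $\Omega$. For $\gamma>-1$ let $a_w^\gamma$ be the normalization constant such that $\int_{[-1,1]^2}a_w^\gamma\,w(x)w(y)|x-y|^{2\gamma+1}\,dx\,dy=1$, and define the weight on $\Omega$ $$W_\gamma(u,v)=2a_w^\gamma\,w(x)w(y)(u^2-4v)^{\gamma},\qquad u=x+y,\;v=xy,$$ which is normalized to have integral $1$ over $\Omega$; one has $\int_\Omega f(u,v)W_\gamma(u,v)\,du\,dv=\int_{[-1,1]^2}f(x+y,xy)\,a_w^\gamma w(x)w(y)|x-y|^{2\gamma+1}\,dx\,dy$. $\Pi_n^2$ is the space of polynomials in two variables of total degree at most $n$. The reproducing kernel $K_n^{(\gamma)}(\cdot,\cdot)$ for $W_\gamma$ is the reproducing kernel of $\Pi_n^2$ in $L^2(W_\gamma)$, defined uniquely by $\int_\Omega K_n^{(\gamma)}(u,v)f(v)W_\gamma(v)\,dv=f(u)$ for all $f\in\Pi_n^2$ (here $u$ and $v$ are points of $\Omega$).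
   Formalization: Both right-hand sides carry an extra factor 1/a_w^γ, since W_γ has integral 1 (for w=1/2, n=0, γ=1/2 the printed side is 3/2, not 1); Ω gets the condition |u|<2 so that the stated bijection with the triangle holds; w is assumed to have positive integral. *)

theory Defs
  imports "HOL-Analysis.Analysis" "HOL-Computational_Algebra.Polynomial"
begin

section \<open>One variable\<close>

text \<open>Measurability of the weight is contained in the case \<open>k = 0\<close> of the moment condition.
  Positivity of the total mass is what makes \<open>L\<^sup>2(w)\<close> norms definite on polynomials, so
  that the orthonormal polynomials and the normalization constants below exist.\<close>

definition weight_function :: "(real \<Rightarrow> real) \<Rightarrow> bool" where
  "weight_function w \<longleftrightarrow>
     (\<forall>x\<in>{-1..1}. 0 \<le> w x) \<and>
     (\<forall>k::nat. set_integrable lebesgue {-1..1} (\<lambda>x. x ^ k * w x)) \<and>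
     0 < (LINT x:{-1..1}|lebesgue. w x)"

definition orthonormal_polys :: "(real \<Rightarrow> real) \<Rightarrow> nat \<Rightarrow> real poly" where
  "orthonormal_polys w = (THE p.
     (\<forall>n. degree (p n) = n \<and> 0 < lead_coeff (p n)) \<and>
     (\<forall>n m. (LINT x:{-1..1}|lebesgue. poly (p n) x * poly (p m) x * w x) =
             (if n = m then 1 else 0)))"

definition kernel1 :: "(real \<Rightarrow> real) \<Rightarrow> nat \<Rightarrow> real \<Rightarrow> real \<Rightarrow> real" where
  "kernel1 w n x y =
     (\<Sum>k\<le>n. poly (orthonormal_polys w k) x * poly (orthonormal_polys w k) y)"

section \<open>Two variables\<close>

text \<open>The first three inequalities alone also hold at \<open>(x + y, x y)\<close> when \<open>x\<close> and \<open>y\<close> are both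
  greater than \<open>1\<close> or both less than \<open>-1\<close>; the condition \<open>\<bar>u\<bar> < 2\<close> selects the bounded component,
  which is the image of the triangle \<open>-1 < x < y < 1\<close>.\<close>

definition Omega :: "(real \<times> real) set" where
  "Omega = {(u, v). 1 + u + v > 0 \<and> 1 - u + v > 0 \<and> u\<^sup>2 > 4 * v \<and> \<bar>u\<bar> < 2}"

lemma Omega_bij:
  "bij_betw (\<lambda>(x, y). (x + y, x * y)) {(x, y). -1 < x \<and> x < y \<and> y < 1} Omega"
proof (rule bij_betw_byWitness
    [where f' = "\<lambda>(u, v). ((u - sqrt (u\<^sup>2 - 4 * v)) / 2, (u + sqrt (u\<^sup>2 - 4 * v)) / 2)"])
  have sq: "sqrt ((x + y)\<^sup>2 - 4 * (x * y)) = y - x" if "x < y" for x y :: real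
  proof -
    have "(x + y)\<^sup>2 - 4 * (x * y) = (y - x)\<^sup>2"
      by (simp add: power2_eq_square algebra_simps)
    then show ?thesis using that by simp
  qed
  show "\<forall>a\<in>{(x, y). -1 < x \<and> x < y \<and> y < 1}.
      (case (case a of (x, y) \<Rightarrow> (x + y, x * y)) of (u, v) \<Rightarrow>
         ((u - sqrt (u\<^sup>2 - 4 * v)) / 2, (u + sqrt (u\<^sup>2 - 4 * v)) / 2)) = a"
    by (auto simp: sq)
  have root: "(u - sqrt (u\<^sup>2 - 4 * v)) / 2 * ((u + sqrt (u\<^sup>2 - 4 * v)) / 2) = v"
    if "u\<^sup>2 > 4 * v" for u v :: real
  proof -
    have "(u - sqrt (u\<^sup>2 - 4 * v)) * (u + sqrt (u\<^sup>2 - 4 * v)) = u\<^sup>2 - (sqrt (u\<^sup>2 - 4 * v))\<^sup>2"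
      by (simp add: power2_eq_square algebra_simps)
    also have "\<dots> = 4 * v" using that by simp
    finally show ?thesis by simp
  qed
  then show "\<forall>a'\<in>Omega. (case (case a' of (u, v) \<Rightarrow>
         ((u - sqrt (u\<^sup>2 - 4 * v)) / 2, (u + sqrt (u\<^sup>2 - 4 * v)) / 2)) of
         (x, y) \<Rightarrow> (x + y, x * y)) = a'"
    by (auto simp: Omega_def add_divide_distrib diff_divide_distrib)
  show "(\<lambda>(x, y). (x + y, x * y)) ` {(x, y). -1 < x \<and> x < y \<and> y < 1} \<subseteq> Omega"
  proof (clarsimp simp: Omega_def)
    fix x y :: real assume h: "-1 < x" "x < y" "y < 1"
    have "0 < (1 + x) * (1 + y)" "0 < (1 - x) * (1 - y)" "0 < (x - y) * (x - y)"
      using h by (auto intro: mult_pos_pos mult_neg_neg)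
    then show "0 < 1 + (x + y) + x * y \<and> 0 < 1 - (x + y) + x * y \<and>
        4 * (x * y) < (x + y)\<^sup>2 \<and> \<bar>x + y\<bar> < 2"
      using h by (auto simp: power2_eq_square algebra_simps)
  qed
  have "sqrt (u\<^sup>2 - 4 * v) < u + 2 \<and> sqrt (u\<^sup>2 - 4 * v) < 2 - u \<and> 0 < sqrt (u\<^sup>2 - 4 * v)"
    if "(u, v) \<in> Omega" for u v :: real
  proof -
    have h: "0 < 1 + u + v" "0 < 1 - u + v" "4 * v < u\<^sup>2" "- 2 < u" "u < 2"
      using that by (auto simp: Omega_def)
    have "u\<^sup>2 - 4 * v < (u + 2)\<^sup>2" "u\<^sup>2 - 4 * v < (2 - u)\<^sup>2"
      using h by (auto simp: power2_eq_square algebra_simps)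
    then show ?thesis using h by (auto intro: real_less_lsqrt)
  qed
  then show "(\<lambda>(u, v). ((u - sqrt (u\<^sup>2 - 4 * v)) / 2, (u + sqrt (u\<^sup>2 - 4 * v)) / 2)) ` Omega
      \<subseteq> {(x, y). -1 < x \<and> x < y \<and> y < 1}"
    by fastforce
qed

definition norm_const :: "(real \<Rightarrow> real) \<Rightarrow> real \<Rightarrow> real" where
  "norm_const w \<gamma> =
     1 / set_lebesgue_integral lebesgue ({-1..1} \<times> {-1..1})
           (\<lambda>(x, y). w x * w y * \<bar>x - y\<bar> powr (2 * \<gamma> + 1))"

text \<open>The preimage \<open>(x, y)\<close> of \<open>(u, v)\<close> is the ordered pair of roots of \<open>t\<^sup>2 - u t + v\<close>.\<close>

definition W :: "(real \<Rightarrow> real) \<Rightarrow> real \<Rightarrow> real \<times> real \<Rightarrow> real" where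
  "W w \<gamma> = (\<lambda>(u, v).
     let x = (u - sqrt (u\<^sup>2 - 4 * v)) / 2; y = (u + sqrt (u\<^sup>2 - 4 * v)) / 2
     in 2 * norm_const w \<gamma> * w x * w y * (u\<^sup>2 - 4 * v) powr \<gamma>)"

definition Pi2 :: "nat \<Rightarrow> (real \<times> real \<Rightarrow> real) set" where
  "Pi2 n = {f. \<exists>c :: nat \<Rightarrow> nat \<Rightarrow> real.
     f = (\<lambda>(s, t). \<Sum>i\<le>n. \<Sum>j\<le>n - i. c i j * s ^ i * t ^ j)}"

text \<open>The kernel at \<open>u\<close> is the element of \<open>Pi2 n\<close> representing evaluation at \<open>u\<close>. Membership
  in \<open>Pi2 n\<close> is part of being a reproducing kernel of that space and is what makes it unique.\<close>

definition kernel2 ::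
    "(real \<Rightarrow> real) \<Rightarrow> real \<Rightarrow> nat \<Rightarrow> real \<times> real \<Rightarrow> real \<times> real \<Rightarrow> real" where
  "kernel2 w \<gamma> n u = (THE q. q \<in> Pi2 n \<and>
     (\<forall>f\<in>Pi2 n. (LINT v:Omega|lebesgue. q v * f v * W w \<gamma> v) = f u))"

text \<open>Pitfall: \<open>W\<close> has integral \<open>1\<close> over \<open>Omega\<close>, so \<open>kernel2 w \<gamma> 0\<close> is constantly \<open>1\<close>, whereas
  \<open>kernel1\<close> is taken with respect to \<open>w\<close> as it stands. The product and determinant expressions in
  \<open>kernel1\<close> reproduce with respect to \<open>W\<close> stripped of the factor \<open>norm_const w \<gamma>\<close>; for \<open>n = 0\<close>
  they are equal to \<open>norm_const w \<gamma>\<close>. Hence the kernels of \<open>W\<close> are these expressions divided by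
  \<open>norm_const w \<gamma>\<close>, which is \<open>1\<close> for \<open>\<gamma> = -1/2\<close> when \<open>w\<close> has integral \<open>1\<close>, but in general not
  for \<open>\<gamma> = 1/2\<close>.\<close>

end

theory Submission imports Defs begin

text \<open>
  Put \<open>m = 2 \<gamma> + 1\<close>, so that \<open>m = 0\<close> for \<open>\<gamma> = -1/2\<close> and \<open>m = 2\<close> for \<open>\<gamma> = 1/2\<close>, and let
  \<open>V (x, y) = (x + y, x y)\<close> (called \<open>vieta\<close> below). The Jacobian of \<open>V\<close> on \<open>x < y\<close> is \<open>y - x\<close>, so
  integration against \<open>W w \<gamma>\<close> over \<open>Omega\<close> is, up to the factor \<open>norm_const w \<gamma>\<close>, integration of
  \<open>f (V (x, y)) \<bar>x - y\<bar>\<^sup>m\<close> against the product of two copies of \<open>w\<close> (\<open>integral_Omega_W\<close>). If \<open>f\<close> has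
  total degree at most \<open>n\<close>, then \<open>f \<circ> V\<close> is symmetric and has degree at most \<open>n\<close> in each variable,
  and \<open>k (x1, \<cdot>) k (x2, \<cdot>)\<close> integrates every polynomial of that kind to its value at \<open>(x1, x2)\<close>, by
  Fubini and the one-variable reproducing property (\<open>kernel_product_reproduces\<close>).

  For \<open>m = 0\<close>, the symmetrized product of the kernels of degree \<open>n\<close> therefore reproduces \<open>f \<circ> V\<close>.
  For \<open>m = 2\<close>, one factor \<open>x - y\<close> of the density is absorbed into the candidate kernel, which
  becomes a determinant, and the other into \<open>f\<close>. Both are then antisymmetric, of degree at most
  \<open>n + 1\<close> in each variable, and the kernels of degree \<open>n + 1\<close> reproduce \<open>(x - y) f (V (x, y))\<close>.

  Such an expression is the kernel only if it lies in \<open>Pi2 n\<close> as a function of \<open>(u, v)\<close>. That is the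
  fundamental theorem on symmetric polynomials in a form that controls degrees: a symmetric
  polynomial of degree at most \<open>n\<close> in each variable has total degree at most \<open>n\<close> in \<open>x + y\<close> and
  \<open>x y\<close> (\<open>symmetric_product_Pi2\<close>), and an antisymmetric one loses a degree on division by \<open>x - y\<close>
  (\<open>antisymmetric_product_Pi2\<close>). Finally, representers are unique: the difference of two
  representers of the same evaluation vanishes on \<open>Omega\<close>, as pairing it with the representer at any
  other point shows, and hence vanishes identically, being a polynomial (\<open>kernel2_eqI\<close>).

  The weight \<open>w\<close> is only Lebesgue measurable, whereas Fubini's theorem and image measures are used
  for Borel functions. So \<open>w\<close> is replaced by a Borel function \<open>h\<close> that agrees with it almost
  everywhere and vanishes outside the open interval; the exceptional null set stays null in the
  product and under \<open>V\<close> (\<open>AE_lborel_both_coordinates\<close>, \<open>AE_Omega_roots\<close>).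
\<close>

section \<open>The substitution by sum and product\<close>

definition vieta :: "real \<times> real \<Rightarrow> real \<times> real" where
  "vieta = (\<lambda>(x, y). (x + y, x * y))"

lemma vieta_measurable [measurable]: "vieta \<in> borel_measurable borel"
  unfolding vieta_def by (intro borel_measurable_continuous_onI) (auto simp: split_def intro!: continuous_intros)

lemma open_Omega: "open Omega"
proof -
  have eq: "Omega = {p. 0 < 1 + fst p + snd p} \<inter> {p. 0 < 1 - fst p + snd p}
      \<inter> {p. 4 * snd p < (fst p)\<^sup>2} \<inter> {p. \<bar>fst p\<bar> < 2}"
    by (auto simp: Omega_def)
  show ?thesis
    unfolding eq by (intro open_Int open_Collect_less continuous_intros)
qed

lemma Omega_measurable [measurable]: "Omega \<in> sets borel"
  using open_Omega by simp

text \<open>The defining inequalities of \<open>Omega\<close> at \<open>(x + y, x y)\<close> factor as \<open>(1 + x) (1 + y) > 0\<close>,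
  \<open>(1 - x) (1 - y) > 0\<close> and \<open>(y - x)\<^sup>2 > 0\<close>; the bound on \<open>\<bar>x + y\<bar>\<close> excludes that both factors of
  one product are negative.\<close>

lemma vieta_mem_Omega_iff:
  assumes "x \<le> y"
  shows "vieta (x, y) \<in> Omega \<longleftrightarrow> -1 < x \<and> x < y \<and> y < 1"
proof
  assume "-1 < x \<and> x < y \<and> y < 1"
  then show "vieta (x, y) \<in> Omega"
    using bij_betwE[OF Omega_bij] by (auto simp: vieta_def)
next
  assume "vieta (x, y) \<in> Omega"
  then have h: "0 < (1 + x) * (1 + y)" "0 < (1 - x) * (1 - y)" "0 < (y - x)\<^sup>2" "\<bar>x + y\<bar> < 2"
    by (auto simp: Omega_def vieta_def algebra_simps power2_eq_square)
  then show "-1 < x \<and> x < y \<and> y < 1"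
    using assms by (auto simp: zero_less_mult_iff)
qed

text \<open>The two-dimensional substitution is reduced to one dimension by keeping the sum \<open>u\<close> as a
  coordinate: with \<open>y = u - x\<close> the product is \<open>x (u - x)\<close>, whose derivative \<open>u - 2 x = y - x\<close> is
  the Jacobian. For fixed \<open>u\<close> the product is increasing on \<open>max (-1) (u - 1) \<le> x \<le> u / 2\<close>, and its
  values at the end points are exactly the bounds that \<open>Omega\<close> imposes on \<open>v\<close>.\<close>

lemma vieta_substitution_slice:
  assumes A [measurable]: "A \<in> sets (borel :: (real \<times> real) measure)"
  shows "(\<integral>\<^sup>+v. indicator (A \<inter> Omega) (u, v) \<partial>lborel) =
         (\<integral>\<^sup>+x. indicator (A \<inter> Omega) (vieta (x, u - x)) * ennreal (u - x - x) \<partial>lborel)"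
proof (cases "\<bar>u\<bar> < 2")
  case False
  then have "(u, v) \<notin> Omega" for v by (auto simp: Omega_def)
  then show ?thesis by (simp add: vieta_def)
next
  case True
  define a b where "a = max (- 1) (u - 1)" and "b = u / 2"
  define g where "g x = x * (u - x)" for x
  have ab: "a \<le> b" using True by (auto simp: a_def b_def max_def)
  have ga: "g a = \<bar>u\<bar> - 1" and gb: "g b = u\<^sup>2 / 4"
    by (auto simp: g_def a_def b_def max_def algebra_simps power2_eq_square)
  have 1: "indicator (A \<inter> Omega) (u, v) = ennreal (indicator (A \<inter> Omega) (u, v) * indicator {g a..g b} v)" for v
    unfolding ga gb by (auto simp: indicator_def Omega_def)
  have 2: "indicator (A \<inter> Omega) (vieta (x, u - x)) * ennreal (u - x - x) =
     ennreal (indicator (A \<inter> Omega) (u, g x) * (u - x - x) * indicator {a..b} x)" for x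
  proof (cases "x \<le> b")
    case True
    then have "x \<le> u - x" by (simp add: b_def)
    from vieta_mem_Omega_iff[OF this] show ?thesis using True
      by (auto simp: indicator_def a_def g_def vieta_def)
  next
    case False
    then show ?thesis by (auto simp: b_def indicator_def ennreal_neg)
  qed
  have "(\<integral>\<^sup>+v. ennreal (indicator (A \<inter> Omega) (u, v) * indicator {g a..g b} v) \<partial>lborel) =
     (\<integral>\<^sup>+x. ennreal (indicator (A \<inter> Omega) (u, g x) * (u - x - x) * indicator {a..b} x) \<partial>lborel)"
  proof (rule nn_integral_substitution)
    show "set_borel_measurable borel {g a..g b} (\<lambda>v. indicat_real (A \<inter> Omega) (u, v))"
      unfolding set_borel_measurable_def by measurable
    show "(g has_real_derivative (u - x - x)) (at x)" for x
      unfolding g_def by (auto intro!: derivative_eq_intros)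
  qed (use ab in \<open>auto simp: b_def intro!: continuous_intros\<close>)
  then show ?thesis by (simp only: 1 2)
qed

lemma vieta_density_measurable:
  "(\<lambda>p. indicator Omega (vieta p) * ennreal (snd p - fst p)) \<in> borel_measurable lborel"
proof -
  have [measurable]: "Omega \<in> sets (borel \<Otimes>\<^sub>M borel)"
    "vieta \<in> borel \<Otimes>\<^sub>M borel \<rightarrow>\<^sub>M borel \<Otimes>\<^sub>M borel"
    using Omega_measurable vieta_measurable unfolding borel_prod by auto
  have "(\<lambda>p. indicator Omega (vieta p) * ennreal (snd p - fst p)) \<in> borel_measurable (borel \<Otimes>\<^sub>M borel)"
    by measurable
  then show ?thesis by (simp add: borel_prod)
qed

text \<open>The change of variables on \<open>Omega\<close> as an identity of measures, so that it applies to every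
  integrand at once. The Jacobian is written as \<open>ennreal (y - x)\<close>, which is \<open>0\<close> for \<open>y \<le> x\<close> and so
  selects one of the two preimages. Under Fubini, the shift \<open>y = u - x\<close> in the inner integral
  reduces the claim to the substitution on slices of constant \<open>u\<close>.\<close>

lemma distr_vieta:
  "density lborel (indicator Omega) =
   distr (density lborel (\<lambda>p. indicator Omega (vieta p) * ennreal (snd p - fst p))) borel vieta"
  (is "?L = distr (density lborel ?j) borel vieta")
proof (rule measure_eqI)
  fix A assume "A \<in> sets ?L"
  then have A [measurable]: "A \<in> sets borel" by simp
  let ?I = "indicator (A \<inter> Omega) :: real \<times> real \<Rightarrow> ennreal"
  have [measurable]: "A \<in> sets (borel \<Otimes>\<^sub>M borel)" "Omega \<in> sets (borel \<Otimes>\<^sub>M borel)"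
    "vieta \<in> borel \<Otimes>\<^sub>M borel \<rightarrow>\<^sub>M borel \<Otimes>\<^sub>M borel"
    using A Omega_measurable vieta_measurable unfolding borel_prod by auto
  have [measurable]: "vieta -` A \<in> sets borel"
    using measurable_sets[OF vieta_measurable A] by simp
  have "emeasure ?L A = (\<integral>\<^sup>+p. ?I p \<partial>(lborel \<Otimes>\<^sub>M lborel))"
    by (auto simp: emeasure_density lborel_prod indicator_def intro!: nn_integral_cong)
  also have "\<dots> = (\<integral>\<^sup>+u. (\<integral>\<^sup>+v. ?I (u, v) \<partial>lborel) \<partial>lborel)"
    by (rule lborel.nn_integral_fst[symmetric]) measurable
  also have "\<dots> = (\<integral>\<^sup>+u. (\<integral>\<^sup>+x. ?I (vieta (x, u - x)) * ennreal (u - x - x) \<partial>lborel) \<partial>lborel)"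
    by (simp add: vieta_substitution_slice)
  also have "\<dots> = (\<integral>\<^sup>+x. (\<integral>\<^sup>+u. ?I (vieta (x, u - x)) * ennreal (u - x - x) \<partial>lborel) \<partial>lborel)"
    by (rule lborel_pair.Fubini') measurable
  also have "\<dots> = (\<integral>\<^sup>+x. (\<integral>\<^sup>+y. ?I (vieta (x, y)) * ennreal (y - x) \<partial>lborel) \<partial>lborel)"
  proof (rule nn_integral_cong)
    fix x :: real
    show "(\<integral>\<^sup>+u. ?I (vieta (x, u - x)) * ennreal (u - x - x) \<partial>lborel) =
       (\<integral>\<^sup>+y. ?I (vieta (x, y)) * ennreal (y - x) \<partial>lborel)"
      by (subst nn_integral_real_affine[where c = 1 and t = x]) simp_all
  qed
  also have "\<dots> = (\<integral>\<^sup>+p. ?I (vieta p) * ennreal (snd p - fst p) \<partial>(lborel \<Otimes>\<^sub>M lborel))"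
    by (subst lborel.nn_integral_fst[symmetric]) simp_all
  also have "\<dots> = (\<integral>\<^sup>+p. ?j p * indicator (vieta -` A) p \<partial>lborel)"
    by (auto simp: lborel_prod indicator_def intro!: nn_integral_cong)
  also have "\<dots> = emeasure (distr (density lborel ?j) borel vieta) A"
    by (simp add: emeasure_distr emeasure_density[OF vieta_density_measurable])
  finally show "emeasure ?L A = emeasure (distr (density lborel ?j) borel vieta) A" .
qed simp

section \<open>Symmetric and antisymmetric polynomials\<close>

lemma Pi2_eq: "Pi2 n = {f. \<exists>c. f = (\<lambda>z. \<Sum>i\<le>n. \<Sum>j\<le>n - i. c i j * (fst z ^ i * snd z ^ j))}"
  by (simp add: Pi2_def case_prod_unfold mult.assoc)

lemma Pi2_add: "f \<in> Pi2 n \<Longrightarrow> g \<in> Pi2 n \<Longrightarrow> (\<lambda>z. f z + g z) \<in> Pi2 n"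
  unfolding Pi2_eq
proof clarify
  fix c d :: "nat \<Rightarrow> nat \<Rightarrow> real"
  show "\<exists>e. (\<lambda>z :: real \<times> real. (\<Sum>i\<le>n. \<Sum>j\<le>n - i. c i j * (fst z ^ i * snd z ^ j)) +
      (\<Sum>i\<le>n. \<Sum>j\<le>n - i. d i j * (fst z ^ i * snd z ^ j))) =
      (\<lambda>z. \<Sum>i\<le>n. \<Sum>j\<le>n - i. e i j * (fst z ^ i * snd z ^ j))"
    by (rule exI[of _ "\<lambda>i j. c i j + d i j"]) (simp add: sum.distrib distrib_right)
qed

lemma Pi2_scale: "f \<in> Pi2 n \<Longrightarrow> (\<lambda>z. a * f z) \<in> Pi2 n"
  unfolding Pi2_eq
proof clarify
  fix c :: "nat \<Rightarrow> nat \<Rightarrow> real"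
  show "\<exists>e. (\<lambda>z :: real \<times> real. a * (\<Sum>i\<le>n. \<Sum>j\<le>n - i. c i j * (fst z ^ i * snd z ^ j))) =
      (\<lambda>z. \<Sum>i\<le>n. \<Sum>j\<le>n - i. e i j * (fst z ^ i * snd z ^ j))"
    by (rule exI[of _ "\<lambda>i j. a * c i j"]) (simp add: sum_distrib_left mult.assoc)
qed

lemma Pi2_diff: "f \<in> Pi2 n \<Longrightarrow> g \<in> Pi2 n \<Longrightarrow> (\<lambda>z. f z - g z) \<in> Pi2 n"
  using Pi2_add[of f n "\<lambda>z. - 1 * g z"] Pi2_scale[of g n "-1"] by simp

lemma Pi2_zero: "(\<lambda>z. 0) \<in> Pi2 n"
  unfolding Pi2_eq by (auto intro!: exI[of _ "\<lambda>_ _. 0"])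

lemma Pi2_sum: "(\<And>k. k \<in> A \<Longrightarrow> f k \<in> Pi2 n) \<Longrightarrow> (\<lambda>z. \<Sum>k\<in>A. f k z) \<in> Pi2 n"
  by (induction A rule: infinite_finite_induct) (auto intro: Pi2_zero Pi2_add)

lemma Pi2_monomial:
  assumes "i + j \<le> n"
  shows "(\<lambda>z. fst z ^ i * snd z ^ j) \<in> Pi2 n"
proof -
  have "(\<Sum>a\<le>n. \<Sum>b\<le>n - a. (if b = j then if a = i then 1 else 0 else 0) * (fst z ^ a * snd z ^ b)) =
      fst z ^ i * snd z ^ j" for z :: "real \<times> real"
  proof -
    have "(\<Sum>a\<le>n. \<Sum>b\<le>n - a. (if b = j then if a = i then 1 else 0 else 0) * (fst z ^ a * snd z ^ b)) =
      (\<Sum>a\<le>n. if a = i then fst z ^ i * snd z ^ j else 0)"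
      using assms by (intro sum.cong) (auto simp: if_distrib[of "\<lambda>c. c * _"] sum.delta cong: if_cong)
    then show ?thesis using assms by simp
  qed
  then show ?thesis unfolding Pi2_eq
    by (auto simp: fun_eq_iff intro!: exI[of _ "\<lambda>a b. if b = j then if a = i then 1 else 0 else 0"])
qed

lemma Pi2_const: "(\<lambda>z. a) \<in> Pi2 n"
  using Pi2_scale[OF Pi2_monomial[of 0 0 n], of a] by simp

text \<open>The only products needed in \<open>Pi2\<close> are those with monomials, which shift the exponents.\<close>

lemma Pi2_mult_monomial:
  assumes "f \<in> Pi2 m" and "m + a + b \<le> n"
  shows "(\<lambda>z. fst z ^ a * snd z ^ b * f z) \<in> Pi2 n"
proof -
  obtain c where f: "f = (\<lambda>z. \<Sum>i\<le>m. \<Sum>j\<le>m - i. c i j * (fst z ^ i * snd z ^ j))"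
    using assms(1) unfolding Pi2_eq by blast
  have "(\<lambda>z. \<Sum>i\<le>m. \<Sum>j\<le>m - i. c i j * (fst z ^ (a + i) * snd z ^ (b + j))) \<in> Pi2 n"
    using assms(2) by (intro Pi2_sum Pi2_scale Pi2_monomial) auto
  then show ?thesis by (simp add: f sum_distrib_left power_add mult_ac)
qed

lemma Pi2_mono: "f \<in> Pi2 m \<Longrightarrow> m \<le> n \<Longrightarrow> f \<in> Pi2 n"
  using Pi2_mult_monomial[of f m 0 0 n] by simp

lemma Pi2_mult_fst: "f \<in> Pi2 n \<Longrightarrow> (\<lambda>z. fst z * f z) \<in> Pi2 (Suc n)"
  using Pi2_mult_monomial[of f n 1 0 "Suc n"] by simp

lemma Pi2_mult_snd: "f \<in> Pi2 n \<Longrightarrow> (\<lambda>z. snd z * f z) \<in> Pi2 (Suc n)"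
  using Pi2_mult_monomial[of f n 0 1 "Suc n"] by simp

lemma Pi2_continuous: "f \<in> Pi2 n \<Longrightarrow> continuous_on S f"
  unfolding Pi2_eq by (auto intro!: continuous_intros)

text \<open>Used with two substitutions: a line through two points, and \<open>(x + y, x y)\<close> with one of the
  variables kept fixed. Both components are affine in the remaining variable, so that total degree
  \<open>n\<close> bounds the degree of the result.\<close>

lemma Pi2_poly_substitution:
  assumes "f \<in> Pi2 n" and "degree A \<le> 1" and "degree B \<le> 1"
  shows "\<exists>r. degree r \<le> n \<and> (\<forall>x. f (poly A x, poly B x) = poly r x)"
proof -
  obtain c where f: "f = (\<lambda>z. \<Sum>i\<le>n. \<Sum>j\<le>n - i. c i j * (fst z ^ i * snd z ^ j))"
    using assms(1) unfolding Pi2_eq by blast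
  have "degree (smult (c i j) (A ^ i * B ^ j)) \<le> n" if "i \<le> n" "j \<le> n - i" for i j
  proof -
    have "degree (smult (c i j) (A ^ i * B ^ j)) \<le> degree (A ^ i) + degree (B ^ j)"
      by (rule order.trans[OF degree_smult_le degree_mult_le])
    also have "\<dots> \<le> degree A * i + degree B * j" by (intro add_mono degree_power_le)
    also have "\<dots> \<le> 1 * i + 1 * j" by (intro add_mono mult_right_mono assms) auto
    finally show ?thesis using that by simp
  qed
  then have "degree (\<Sum>i\<le>n. \<Sum>j\<le>n - i. smult (c i j) (A ^ i * B ^ j)) \<le> n"
    by (intro degree_sum_le) auto
  then show ?thesis
    by (intro exI[of _ "\<Sum>i\<le>n. \<Sum>j\<le>n - i. smult (c i j) (A ^ i * B ^ j)"])
      (simp add: f poly_sum)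
qed

text \<open>Along the line from a point of the open set to \<open>z\<close> the function is a polynomial in one variable
  with infinitely many zeros.\<close>

lemma Pi2_eq_zero_if_zero_on_open:
  assumes f: "f \<in> Pi2 n" and S: "open S" "S \<noteq> {}" and zero: "\<And>z. z \<in> S \<Longrightarrow> f z = 0"
  shows "f z = 0"
proof -
  obtain p where p: "p \<in> S" using S by blast
  let ?A = "[:fst p, fst z - fst p:]" and ?B = "[:snd p, snd z - snd p:]"
  let ?l = "\<lambda>x. (poly ?A x, poly ?B x)"
  have "degree ?A \<le> 1" "degree ?B \<le> 1"
    by (rule order.trans[OF degree_pCons_le], simp)+
  then obtain r where r: "\<And>x. f (?l x) = poly r x"
    using Pi2_poly_substitution[OF f] by blast
  have "open (?l -` S)"
    by (intro continuous_open_vimage S) (auto intro!: continuous_intros)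
  moreover have "0 \<in> ?l -` S" using p by simp
  ultimately have "infinite (?l -` S)"
    using finite_imp_not_open by blast
  moreover have "?l -` S \<subseteq> {x. poly r x = 0}"
    using r zero by fastforce
  ultimately have "infinite {x. poly r x = 0}" using infinite_super by blast
  then have "r = 0" using poly_roots_finite by blast
  then show ?thesis using r[of 1] by simp
qed

text \<open>Both \<open>x\<close> and \<open>y\<close> satisfy \<open>t\<^sup>2 = (x + y) t - x y\<close>, so any combination \<open>a\<^sub>m = \<alpha> x\<^sup>m + \<beta> y\<^sup>m\<close> obeys
  \<open>a\<^sub>m\<^sub>+\<^sub>2 = (x + y) a\<^sub>m\<^sub>+\<^sub>1 - x y a\<^sub>m\<close>. One step of this recursion raises the total degree in the
  elementary symmetric polynomials by one only; this is Newton's identity in two variables.\<close>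

lemma power_sum_Pi2: "\<exists>q\<in>Pi2 m. \<forall>x y. q (x + y, x * y) = x ^ m + y ^ m"
proof (induction m rule: induct_nat_012)
  case 0
  show ?case using Pi2_const[of 2 0] by (intro bexI[of _ "\<lambda>z. 2"]) auto
next
  case 1
  show ?case using Pi2_mult_fst[OF Pi2_const[of 1 0]] by (intro bexI[of _ "\<lambda>z. fst z"]) auto
next
  case (ge2 m)
  then obtain q r where q: "q \<in> Pi2 m" "\<And>x y. q (x + y, x * y) = x ^ m + y ^ m"
    and r: "r \<in> Pi2 (Suc m)" "\<And>x y. r (x + y, x * y) = x ^ Suc m + y ^ Suc m"
    by blast
  have "(\<lambda>z. fst z * r z - snd z * q z) \<in> Pi2 (Suc (Suc m))"
    by (intro Pi2_diff Pi2_mult_fst r Pi2_mono[OF Pi2_mult_snd[OF q(1)]]) simp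
  then show ?case
    by (intro bexI[of _ "\<lambda>z. fst z * r z - snd z * q z"]) (auto simp: q r algebra_simps)
qed

text \<open>The quotient \<open>(x\<^sup>m\<^sup>+\<^sup>1 - y\<^sup>m\<^sup>+\<^sup>1) / (x - y)\<close> obeys the same recursion, with initial values \<open>1\<close> and
  \<open>x + y\<close>.\<close>

lemma power_diff_Pi2: "\<exists>q\<in>Pi2 m. \<forall>x y. (x - y) * q (x + y, x * y) = x ^ Suc m - y ^ Suc m"
proof (induction m rule: induct_nat_012)
  case 0
  show ?case using Pi2_const[of 1 0] by (intro bexI[of _ "\<lambda>z. 1"]) auto
next
  case 1
  show ?case using Pi2_mult_fst[OF Pi2_const[of 1 0]]
    by (intro bexI[of _ "\<lambda>z. fst z"]) (auto simp: algebra_simps)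
next
  case (ge2 m)
  then obtain q r where q: "q \<in> Pi2 m" "\<And>x y. (x - y) * q (x + y, x * y) = x ^ Suc m - y ^ Suc m"
    and r: "r \<in> Pi2 (Suc m)" "\<And>x y. (x - y) * r (x + y, x * y) = x ^ Suc (Suc m) - y ^ Suc (Suc m)"
    by blast
  have "(x - y) * ((x + y) * r (x + y, x * y) - x * y * q (x + y, x * y)) =
    x ^ Suc (Suc (Suc m)) - y ^ Suc (Suc (Suc m))" for x y
  proof -
    have "(x - y) * ((x + y) * r (x + y, x * y) - x * y * q (x + y, x * y)) =
      (x + y) * ((x - y) * r (x + y, x * y)) - x * y * ((x - y) * q (x + y, x * y))"
      by (simp add: algebra_simps)
    then show ?thesis unfolding q r by (simp add: algebra_simps)
  qed
  moreover have "(\<lambda>z. fst z * r z - snd z * q z) \<in> Pi2 (Suc (Suc m))"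
    by (intro Pi2_diff Pi2_mult_fst r Pi2_mono[OF Pi2_mult_snd[OF q(1)]]) simp
  ultimately show ?case
    by (intro bexI[of _ "\<lambda>z. fst z * r z - snd z * q z"]) auto
qed

text \<open>For \<open>i \<le> j\<close> the factor \<open>(x y)\<^sup>i\<close> splits off and a power sum of exponent \<open>j - i\<close> remains. The
  total degree \<open>i + (j - i) = j\<close> is the larger of the two exponents and not their sum; this is why
  degree at most \<open>n\<close> in each variable suffices for membership in \<open>Pi2 n\<close>.\<close>

lemma symmetric_monomial_Pi2:
  "i \<le> n \<Longrightarrow> j \<le> n \<Longrightarrow> \<exists>q\<in>Pi2 n. \<forall>x y. q (x + y, x * y) = x ^ i * y ^ j + x ^ j * y ^ i"
proof (induction i j rule: linorder_wlog)
  case (le i j)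
  obtain q where q: "q \<in> Pi2 (j - i)" "\<And>x y. q (x + y, x * y) = x ^ (j - i) + y ^ (j - i)"
    using power_sum_Pi2 by blast
  have "(\<lambda>z. fst z ^ 0 * snd z ^ i * q z) \<in> Pi2 n"
    by (rule Pi2_mult_monomial[OF q(1)]) (use le in auto)
  moreover have "(x * y) ^ i * (x ^ (j - i) + y ^ (j - i)) = x ^ i * y ^ j + x ^ j * y ^ i" for x y :: real
  proof -
    have "x ^ j = x ^ i * x ^ (j - i)" "y ^ j = y ^ i * y ^ (j - i)"
      using le by (simp_all flip: power_add)
    then show ?thesis by (simp add: algebra_simps power_mult_distrib)
  qed
  ultimately show ?case by (intro bexI[of _ "\<lambda>z. fst z ^ 0 * snd z ^ i * q z"]) (auto simp: q)
next
  case (sym i j)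
  then show ?case by (simp add: add.commute)
qed

text \<open>As in the symmetric case, but the division by \<open>x - y\<close> lowers the exponent \<open>j - i\<close> by one, so
  that exponents up to \<open>n + 1\<close> are admitted.\<close>

lemma antisymmetric_monomial_Pi2:
  "i \<le> Suc n \<Longrightarrow> j \<le> Suc n \<Longrightarrow>
    \<exists>q\<in>Pi2 n. \<forall>x y. (x - y) * q (x + y, x * y) = x ^ i * y ^ j - x ^ j * y ^ i"
proof (induction i j rule: linorder_wlog)
  case (le i j)
  show ?case
  proof (cases "i = j")
    case True
    then show ?thesis using Pi2_zero[of n] by (intro bexI[of _ "\<lambda>z. 0"]) auto
  next
    case False
    define m where "m = j - i - 1"
    have j: "j = i + Suc m" using False le by (simp add: m_def)
    obtain q where q: "q \<in> Pi2 m" "\<And>x y. (x - y) * q (x + y, x * y) = x ^ Suc m - y ^ Suc m"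
      using power_diff_Pi2 by blast
    have "(\<lambda>z. - 1 * (fst z ^ 0 * snd z ^ i * q z)) \<in> Pi2 n"
      by (intro Pi2_scale Pi2_mult_monomial[OF q(1)]) (use le j in auto)
    moreover have "(x - y) * (- 1 * ((x * y) ^ i * q (x + y, x * y))) = x ^ i * y ^ j - x ^ j * y ^ i" for x y :: real
    proof -
      have "(x - y) * (- 1 * ((x * y) ^ i * q (x + y, x * y))) =
        - ((x * y) ^ i * ((x - y) * q (x + y, x * y)))" by simp
      also have "\<dots> = x ^ i * y ^ j - x ^ j * y ^ i"
        unfolding q j by (simp add: algebra_simps power_mult_distrib power_add)
      finally show ?thesis .
    qed
    ultimately show ?thesis
      by (intro bexI[of _ "\<lambda>z. - 1 * (fst z ^ 0 * snd z ^ i * q z)"]) auto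
  qed
next
  case (sym i j)
  then obtain q where q: "q \<in> Pi2 n" "\<And>x y. (x - y) * q (x + y, x * y) = x ^ j * y ^ i - x ^ i * y ^ j"
    by auto
  then show ?case using Pi2_scale[OF q(1), of "-1"]
    by (intro bexI[of _ "\<lambda>z. - 1 * q z"]) auto
qed

lemma poly_eq_sum_le:
  fixes p :: "real poly"
  assumes "degree p \<le> n"
  shows "poly p x = (\<Sum>i\<le>n. coeff p i * x ^ i)"
  using arg_cong[OF poly_as_sum_of_monoms'[OF assms], of "\<lambda>p. poly p x"]
  by (simp add: poly_sum poly_monom)

lemma symmetric_product_Pi2:
  fixes P Q :: "real poly"
  assumes "degree P \<le> n" and "degree Q \<le> n"
  shows "\<exists>q\<in>Pi2 n. \<forall>x y. q (x + y, x * y) = poly P x * poly Q y + poly Q x * poly P y"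
proof -
  define R where "R i j q \<longleftrightarrow> q \<in> Pi2 n \<and> (\<forall>x y. q (x + y, x * y) = x ^ i * y ^ j + x ^ j * y ^ i)"
    for i j and q :: "real \<times> real \<Rightarrow> real"
  define q where "q i j = (SOME q. R i j q)" for i j
  have R: "R i j (q i j)" if "i \<le> n" "j \<le> n" for i j
    unfolding q_def using symmetric_monomial_Pi2[OF that] by (intro someI_ex[of "R i j"]) (auto simp: R_def)
  then have q: "q i j \<in> Pi2 n" "q i j (x + y, x * y) = x ^ i * y ^ j + x ^ j * y ^ i"
    if "i \<le> n" "j \<le> n" for i j x y
    using that unfolding R_def by auto
  let ?q = "\<lambda>z. \<Sum>i\<le>n. \<Sum>j\<le>n. (coeff P i * coeff Q j) * q i j z"
  have "?q \<in> Pi2 n" by (intro Pi2_sum Pi2_scale q) auto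
  moreover have "?q (x + y, x * y) = poly P x * poly Q y + poly Q x * poly P y" for x y
  proof -
    have "?q (x + y, x * y) =
      (\<Sum>i\<le>n. \<Sum>j\<le>n. coeff P i * x ^ i * (coeff Q j * y ^ j) + coeff P i * y ^ i * (coeff Q j * x ^ j))"
      by (intro sum.cong) (auto simp: q algebra_simps)
    also have "\<dots> = poly P x * poly Q y + poly P y * poly Q x"
      unfolding poly_eq_sum_le[OF assms(1)] poly_eq_sum_le[OF assms(2)] sum_product
      by (simp add: sum.distrib)
    finally show ?thesis by (simp add: mult.commute)
  qed
  ultimately show ?thesis by (intro bexI[of _ ?q] allI)
qed

lemma antisymmetric_product_Pi2:
  fixes P Q :: "real poly"
  assumes "degree P \<le> Suc n" and "degree Q \<le> Suc n"
  shows "\<exists>q\<in>Pi2 n. \<forall>x y. (x - y) * q (x + y, x * y) = poly P x * poly Q y - poly Q x * poly P y"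
proof -
  define R where "R i j q \<longleftrightarrow> q \<in> Pi2 n \<and>
      (\<forall>x y. (x - y) * q (x + y, x * y) = x ^ i * y ^ j - x ^ j * y ^ i)"
    for i j and q :: "real \<times> real \<Rightarrow> real"
  define q where "q i j = (SOME q. R i j q)" for i j
  have R: "R i j (q i j)" if "i \<le> Suc n" "j \<le> Suc n" for i j
    unfolding q_def using antisymmetric_monomial_Pi2[OF that] by (intro someI_ex[of "R i j"]) (auto simp: R_def)
  then have q: "q i j \<in> Pi2 n" "(x - y) * q i j (x + y, x * y) = x ^ i * y ^ j - x ^ j * y ^ i"
    if "i \<le> Suc n" "j \<le> Suc n" for i j x y
    using that unfolding R_def by auto
  let ?q = "\<lambda>z. \<Sum>i\<le>Suc n. \<Sum>j\<le>Suc n. (coeff P i * coeff Q j) * q i j z"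
  have "?q \<in> Pi2 n" by (intro Pi2_sum Pi2_scale q) auto
  moreover have "(x - y) * ?q (x + y, x * y) = poly P x * poly Q y - poly Q x * poly P y" for x y
  proof -
    have "(x - y) * ?q (x + y, x * y) =
      (\<Sum>i\<le>Suc n. \<Sum>j\<le>Suc n. coeff P i * coeff Q j * ((x - y) * q i j (x + y, x * y)))"
      unfolding sum_distrib_left by (intro sum.cong) (auto simp only: mult_ac)
    also have "\<dots> = (\<Sum>i\<le>Suc n. \<Sum>j\<le>Suc n.
        coeff P i * x ^ i * (coeff Q j * y ^ j) - coeff P i * y ^ i * (coeff Q j * x ^ j))"
      by (intro sum.cong refl, subst q(2)) (auto simp: algebra_simps)
    also have "\<dots> = poly P x * poly Q y - poly P y * poly Q x"
      unfolding poly_eq_sum_le[OF assms(1)] poly_eq_sum_le[OF assms(2)] sum_product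
      by (simp only: sum_subtractf)
    finally show ?thesis by (simp add: mult.commute)
  qed
  ultimately show ?thesis by (intro bexI[of _ ?q] allI)
qed

section \<open>Reproducing kernels of an atomless measure\<close>

text \<open>Polynomials with one of each degree below \<open>n\<close> form a basis of the polynomials of degree less
  than \<open>n\<close>. That degree bound is stated through coefficients, because \<open>degree 0 = 0\<close> makes
  \<open>degree r < n\<close> the wrong condition for \<open>n = 0\<close>.\<close>

lemma poly_expansion_exact_degrees:
  fixes Q :: "nat \<Rightarrow> real poly"
  assumes "\<And>k. k < n \<Longrightarrow> degree (Q k) = k \<and> Q k \<noteq> 0" and "\<And>i. n \<le> i \<Longrightarrow> coeff r i = 0"
  shows "\<exists>c. r = (\<Sum>k<n. smult (c k) (Q k))"
  using assms
proof (induction n arbitrary: r)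
  case 0
  then show ?case by (auto simp: poly_eq_iff)
next
  case (Suc n)
  define a where "a = coeff r n / coeff (Q n) n"
  have Qn: "degree (Q n) = n" "coeff (Q n) n \<noteq> 0"
    using Suc.prems(1)[of n] by (auto dest: leading_coeff_neq_0)
  have "coeff (r - smult a (Q n)) i = 0" if "n \<le> i" for i
    using that Suc.prems(2)[of i] Qn by (cases "i = n") (auto simp: a_def coeff_eq_0)
  then obtain c where c: "r - smult a (Q n) = (\<Sum>k<n. smult (c k) (Q k))"
    using Suc.IH[of "r - smult a (Q n)"] Suc.prems(1) less_Suc_eq by metis
  have "(\<Sum>k<n. smult ((c(n := a)) k) (Q k)) = (\<Sum>k<n. smult (c k) (Q k))"
    by (intro sum.cong) auto
  then have "r = (\<Sum>k<Suc n. smult ((c(n := a)) k) (Q k))"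
    using c by (simp add: algebra_simps)
  then show ?case by blast
qed

text \<open>Each slice of the diagonal is a single point, so Fubini applies.\<close>

lemma AE_off_diagonal:
  fixes M1 M2 :: "real measure"
  assumes "pair_sigma_finite M1 M2"
    and sets: "sets M1 = sets borel" "sets M2 = sets borel"
    and atomless: "\<And>a. AE x in M2. x \<noteq> a"
  shows "AE p in M1 \<Otimes>\<^sub>M M2. fst p \<noteq> snd p"
proof -
  interpret pair_sigma_finite M1 M2 by fact
  show ?thesis
  proof (rule AE_pair_measure)
    show "AE x in M1. AE y in M2. fst (x, y) \<noteq> snd (x, y)"
      using atomless by (auto simp: eq_commute)
    have "closed {p :: real \<times> real. fst p = snd p}"
      by (intro closed_Collect_eq continuous_intros)
    moreover have "sets (M1 \<Otimes>\<^sub>M M2) = sets (borel \<Otimes>\<^sub>M borel)"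
      by (intro sets_pair_measure_cong sets)
    ultimately have "- {p :: real \<times> real. fst p = snd p} \<in> sets (M1 \<Otimes>\<^sub>M M2)"
      unfolding borel_prod by (auto intro: borel_open)
    then show "{p \<in> space (M1 \<Otimes>\<^sub>M M2). fst p \<noteq> snd p} \<in> sets (M1 \<Otimes>\<^sub>M M2)"
      using sets_eq_imp_space_eq[OF sets(1)] sets_eq_imp_space_eq[OF sets(2)]
      by (simp add: space_pair_measure Compl_eq)
  qed
qed

text \<open>The measure \<open>w(x) dx\<close> enters only through these properties. Boundedness of the support and
  finiteness make continuous functions integrable. Atomlessness lets one discard the diagonal and
  the zeros of polynomials, so that with \<open>nontrivial\<close> the inner product on polynomials is definite.\<close>

locale atomless_measure = finite_measure M for M :: "real measure" +
  assumes sets_M [simp, measurable_cong]: "sets M = sets borel"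
    and concentrated: "AE x in M. - 1 < x \<and> x < 1"
    and atomless: "AE x in M. x \<noteq> a"
    and nontrivial: "\<not> (AE x in M. False)"
begin

sublocale pair_sigma_finite M M ..

sublocale square: finite_measure "M \<Otimes>\<^sub>M M"
  by (rule finite_measure_pair_measure) unfold_locales

lemma space_M [simp]: "space M = UNIV"
  using sets_eq_imp_space_eq[OF sets_M] by simp

lemma integrable_continuous:
  fixes f :: "real \<Rightarrow> real"
  assumes "continuous_on UNIV f"
  shows "integrable M f"
proof -
  have "compact (f ` {-1..1})"
    by (intro compact_continuous_image continuous_on_subset[OF assms]) auto
  then obtain B where B: "\<forall>x\<in>{-1..1}. \<bar>f x\<bar> \<le> B"
    by (fastforce dest: compact_imp_bounded simp: bounded_real)
  have "AE x in M. norm (f x) \<le> B"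
    using concentrated by eventually_elim (use B in auto)
  moreover have "f \<in> borel_measurable M"
    using borel_measurable_continuous_onI[OF assms] by simp
  ultimately show ?thesis by (rule integrable_const_bound)
qed

lemma sets_square: "sets (M \<Otimes>\<^sub>M M) = sets borel"
proof -
  have "sets (M \<Otimes>\<^sub>M M) = sets (borel \<Otimes>\<^sub>M borel)"
    by (intro sets_pair_measure_cong) simp_all
  then show ?thesis by (simp only: borel_prod)
qed

lemma borel_measurable_square: "borel_measurable (M \<Otimes>\<^sub>M M) = borel_measurable borel"
  by (rule measurable_cong_sets[OF sets_square refl])

lemma square_concentrated: "AE p in M \<Otimes>\<^sub>M M. p \<in> {-1<..<1} \<times> {-1<..<1}"
proof (rule AE_pair_measure)
  show "AE x in M. AE y in M. (x, y) \<in> {-1<..<1} \<times> {-1<..<1}"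
    using concentrated
  proof eventually_elim
    case (elim x)
    show ?case using concentrated by eventually_elim (use elim in auto)
  qed
  have "{p \<in> space (M \<Otimes>\<^sub>M M). p \<in> {-1<..<1} \<times> {-1<..<1}} = {-1<..<1} \<times> {-1<..<1}"
    by (auto simp: space_pair_measure)
  then show "{p \<in> space (M \<Otimes>\<^sub>M M). p \<in> {-1<..<1} \<times> {-1<..<1}} \<in> sets (M \<Otimes>\<^sub>M M)"
    by (simp add: pair_measureI)
qed

lemma square_integrable_continuous:
  fixes f :: "real \<times> real \<Rightarrow> real"
  assumes "continuous_on UNIV f"
  shows "integrable (M \<Otimes>\<^sub>M M) f"
proof -
  have "compact (f ` ({-1..1} \<times> {-1..1}))"
    by (intro compact_continuous_image continuous_on_subset[OF assms] compact_Times) auto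
  then obtain B where B: "\<forall>x\<in>{-1..1} \<times> {-1..1}. \<bar>f x\<bar> \<le> B"
    by (fastforce dest: compact_imp_bounded simp: bounded_real)
  have "AE x in M \<Otimes>\<^sub>M M. norm (f x) \<le> B"
    using square_concentrated by eventually_elim (use B in auto)
  moreover have "f \<in> borel_measurable (M \<Otimes>\<^sub>M M)"
    unfolding borel_measurable_square by (rule borel_measurable_continuous_onI[OF assms])
  ultimately show ?thesis by (rule square.integrable_const_bound)
qed

lemma square_off_diagonal: "AE p in M \<Otimes>\<^sub>M M. fst p \<noteq> snd p"
  by (rule AE_off_diagonal[OF pair_sigma_finite_axioms sets_M sets_M atomless])

text \<open>The half of the square below the diagonal is mapped to the half above it by exchanging the
  coordinates, and the diagonal is a null set.\<close>

lemma integral_symmetric_half: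
  fixes g :: "real \<times> real \<Rightarrow> real"
  assumes cont: "continuous_on UNIV g" and sym: "\<And>x y. g (x, y) = g (y, x)"
  shows "(\<integral>p. g p \<partial>(M \<Otimes>\<^sub>M M)) = 2 * (\<integral>p. indicator {p. fst p < snd p} p * g p \<partial>(M \<Otimes>\<^sub>M M))"
proof -
  let ?lo = "{p :: real \<times> real. fst p < snd p}" and ?hi = "{p :: real \<times> real. snd p < fst p}"
  have sets: "?lo \<in> sets (M \<Otimes>\<^sub>M M)" "?hi \<in> sets (M \<Otimes>\<^sub>M M)"
    unfolding sets_square by (auto intro!: borel_open open_Collect_less continuous_intros)
  note int = square_integrable_continuous[OF cont]
  have int2: "integrable (M \<Otimes>\<^sub>M M) (\<lambda>p. indicator ?lo p * g p)"
    "integrable (M \<Otimes>\<^sub>M M) (\<lambda>p. indicator ?hi p * g p)"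
    using integrable_mult_indicator[OF sets(1) int] integrable_mult_indicator[OF sets(2) int] by simp_all
  have "(\<integral>p. g p \<partial>(M \<Otimes>\<^sub>M M)) = (\<integral>p. indicator ?lo p * g p + indicator ?hi p * g p \<partial>(M \<Otimes>\<^sub>M M))"
    using int int2 square_off_diagonal by (intro integral_cong_AE) (auto simp: indicator_def)
  also have "\<dots> = (\<integral>p. indicator ?lo p * g p \<partial>(M \<Otimes>\<^sub>M M)) + (\<integral>p. indicator ?hi p * g p \<partial>(M \<Otimes>\<^sub>M M))"
    by (rule Bochner_Integration.integral_add[OF int2])
  also have "(\<integral>p. indicator ?hi p * g p \<partial>(M \<Otimes>\<^sub>M M)) = (\<integral>(x, y). indicator ?hi (y, x) * g (y, x) \<partial>(M \<Otimes>\<^sub>M M))"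
    using int2 by (intro integral_product_swap[symmetric]) auto
  also have "\<dots> = (\<integral>p. indicator ?lo p * g p \<partial>(M \<Otimes>\<^sub>M M))"
    by (intro Bochner_Integration.integral_cong) (auto simp: indicator_def sym)
  finally show ?thesis by simp
qed

definition ip :: "real poly \<Rightarrow> real poly \<Rightarrow> real" where
  "ip p q = (\<integral>x. poly p x * poly q x \<partial>M)"

lemma integrable_poly_mult [simp]: "integrable M (\<lambda>x. poly p x * poly q x)"
  by (intro integrable_continuous continuous_intros)

lemma ip_commute: "ip p q = ip q p"
  by (simp add: ip_def mult.commute)

lemma ip_diff_left: "ip (p - q) r = ip p r - ip q r"
  by (simp add: ip_def left_diff_distrib)

lemma ip_smult_left [simp]: "ip (smult a p) r = a * ip p r"
  by (simp add: ip_def mult.assoc)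

lemma ip_smult_right [simp]: "ip r (smult a p) = a * ip r p"
  by (simp add: ip_commute[of r])

lemma ip_sum_left: "ip (\<Sum>k\<in>A. f k) r = (\<Sum>k\<in>A. ip (f k) r)"
  by (simp add: ip_def poly_sum sum_distrib_right Bochner_Integration.integral_sum)

lemma ip_sum_right: "ip r (\<Sum>k\<in>A. f k) = (\<Sum>k\<in>A. ip r (f k))"
  by (simp add: ip_commute[of r] ip_sum_left)

text \<open>A polynomial that vanishes almost everywhere is zero, because otherwise the measure would be
  concentrated on its finitely many roots.\<close>

lemma ip_self_pos:
  assumes "p \<noteq> 0"
  shows "0 < ip p p"
proof (rule ccontr)
  assume "\<not> 0 < ip p p"
  moreover have "0 \<le> ip p p" by (simp add: ip_def)
  ultimately have "ip p p = 0" by simp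
  then have zero: "AE x in M. poly p x * poly p x = 0"
    unfolding ip_def by (subst (asm) integral_nonneg_eq_0_iff_AE) auto
  have "AE x in M. \<forall>r\<in>{r. poly p r = 0}. x \<noteq> r"
    by (intro AE_finite_allI poly_roots_finite assms atomless)
  with zero have "AE x in M. False" by eventually_elim auto
  with nontrivial show False by simp
qed

text \<open>The Gram--Schmidt step: subtract from the power of degree \<open>n\<close> its projections on the
  polynomials already constructed.\<close>

lemma ex_monic_orthogonal:
  "\<exists>q. degree q = n \<and> lead_coeff q = 1 \<and> (\<forall>r. (\<forall>i\<ge>n. coeff r i = 0) \<longrightarrow> ip q r = 0)"
proof (induction n rule: less_induct)
  case (less n)
  obtain Q where Q: "\<And>k. k < n \<Longrightarrow> degree (Q k) = k" "\<And>k. k < n \<Longrightarrow> lead_coeff (Q k) = 1"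
    "\<And>k r. k < n \<Longrightarrow> (\<forall>i\<ge>k. coeff r i = 0) \<Longrightarrow> ip (Q k) r = 0"
    using less.IH by metis
  have ne: "Q k \<noteq> 0" if "k < n" for k using Q(2)[OF that] by auto
  have orth: "ip (Q k) (Q j) = 0" if "k < n" "j < n" "j \<noteq> k" for k j
    using that
  proof (induction j k rule: linorder_wlog)
    case (le j k)
    then show ?case by (intro Q(3)) (auto simp: Q(1) coeff_eq_0)
  next
    case (sym j k)
    then show ?case by (simp add: ip_commute)
  qed
  define s where "s = (\<Sum>k<n. smult (ip (monom 1 n) (Q k) / ip (Q k) (Q k)) (Q k))"
  define q where "q = monom 1 n - s"
  have s: "coeff s i = 0" if "n \<le> i" for i
    using that by (auto simp: s_def coeff_sum Q(1) coeff_eq_0 intro!: sum.neutral)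
  have "coeff q n = 1" using s by (simp add: q_def)
  moreover have "degree q \<le> n" by (rule degree_le) (use s in \<open>auto simp: q_def\<close>)
  ultimately have deg: "degree q = n" "lead_coeff q = 1"
    using le_degree[of q n] by auto
  have qQ: "ip q (Q j) = 0" if "j < n" for j
  proof -
    have "ip s (Q j) = (\<Sum>k<n. if k = j then ip (monom 1 n) (Q j) else 0)"
      unfolding s_def ip_sum_left using that orth ip_self_pos[OF ne[OF that]]
      by (intro sum.cong) auto
    then show ?thesis using that by (simp add: q_def ip_diff_left)
  qed
  have "ip q r = 0" if r: "\<forall>i\<ge>n. coeff r i = 0" for r
  proof -
    obtain c where "r = (\<Sum>k<n. smult (c k) (Q k))"
      using poly_expansion_exact_degrees[of n Q r] Q(1) ne r by blast
    then show ?thesis by (simp add: ip_sum_right qQ)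
  qed
  with deg show ?case by blast
qed

definition orthonormal :: "(nat \<Rightarrow> real poly) \<Rightarrow> bool" where
  "orthonormal p \<longleftrightarrow> (\<forall>n. degree (p n) = n \<and> 0 < lead_coeff (p n)) \<and>
     (\<forall>n m. ip (p n) (p m) = (if n = m then 1 else 0))"

lemma ex_orthonormal: "\<exists>p. orthonormal p"
proof -
  obtain q where q: "\<And>n. degree (q n) = n" "\<And>n. lead_coeff (q n) = 1"
    "\<And>n r. (\<forall>i\<ge>n. coeff r i = 0) \<Longrightarrow> ip (q n) r = 0"
    using ex_monic_orthogonal by metis
  have pos: "0 < ip (q n) (q n)" for n
    using q(2)[of n] by (intro ip_self_pos) auto
  have orth: "ip (q n) (q m) = 0" if "n \<noteq> m" for n m
    using that
  proof (induction m n rule: linorder_wlog)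
    case (le m n)
    then show ?case by (intro q(3)) (auto simp: q(1) coeff_eq_0)
  next
    case (sym m n)
    then show ?case by (simp add: ip_commute)
  qed
  have "orthonormal (\<lambda>n. smult (1 / sqrt (ip (q n) (q n))) (q n))"
    unfolding orthonormal_def using pos q(1,2) orth
    by (auto simp: less_imp_neq[symmetric] less_imp_le real_div_sqrt simp flip: real_sqrt_mult)
  then show ?thesis by blast
qed

lemma orthonormal_expansion:
  assumes "orthonormal p" and "\<And>i. n \<le> i \<Longrightarrow> coeff r i = 0"
  obtains c where "r = (\<Sum>k<n. smult (c k) (p k))"
proof -
  have "p k \<noteq> 0" for k
    using assms(1) unfolding orthonormal_def by (metis less_irrefl leading_coeff_0_iff)
  then show ?thesis
    using poly_expansion_exact_degrees[of n p r] assms that unfolding orthonormal_def by blast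
qed

text \<open>The scalar \<open>c\<close> is chosen such that \<open>d = p\<^sub>n - c q\<^sub>n\<close> has degree below \<open>n\<close>. Then \<open>d\<close> is orthogonal to
  \<open>p\<^sub>n\<close> and to \<open>q\<^sub>n\<close>, hence to itself, so it is zero, and normalization together with the sign of the
  leading coefficients forces \<open>c = 1\<close>.\<close>

lemma orthonormal_unique:
  assumes p: "orthonormal p" and q: "orthonormal q"
  shows "p = q"
proof
  fix n
  have lead: "degree (p n) = n" "0 < coeff (p n) n" "degree (q n) = n" "0 < coeff (q n) n"
    using p q unfolding orthonormal_def by metis+
  define c where "c = coeff (p n) n / coeff (q n) n"
  have "0 < c" using lead by (simp add: c_def)
  define d where "d = p n - smult c (q n)"
  have low: "coeff d i = 0" if "n \<le> i" for i
    using that lead by (cases "i = n") (auto simp: d_def c_def coeff_eq_0)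
  have orth: "ip (r n) d = 0" if r: "orthonormal r" for r
  proof -
    obtain a where "d = (\<Sum>k<n. smult (a k) (r k))"
      using orthonormal_expansion[OF r low] by blast
    then show ?thesis using r by (simp add: ip_sum_right orthonormal_def)
  qed
  have "ip d d = ip (p n) d - c * ip (q n) d"
    by (simp add: d_def ip_diff_left)
  then have "d = 0"
    using orth[OF p] orth[OF q] ip_self_pos[of d] by fastforce
  then have eq: "p n = smult c (q n)" by (simp add: d_def)
  have "1 = ip (p n) (p n)" using p by (simp add: orthonormal_def)
  also have "\<dots> = c * c" using q by (simp add: eq orthonormal_def)
  finally have "c = 1" using \<open>0 < c\<close> by (metis abs_of_pos abs_square_eq_1 power2_eq_square)
  then show "p n = q n" using eq by simp
qed

text \<open>The one-variable kernel with the first argument fixed, as a polynomial in the second one.\<close>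

definition kernel_poly :: "nat \<Rightarrow> real \<Rightarrow> real poly" where
  "kernel_poly n x = (\<Sum>k\<le>n. smult (poly ((THE p. orthonormal p) k) x) ((THE p. orthonormal p) k))"

lemma orthonormal_THE: "orthonormal (THE p. orthonormal p)"
  using ex_orthonormal orthonormal_unique by (metis theI')

lemma degree_kernel_poly: "degree (kernel_poly n x) \<le> n"
proof -
  have "degree ((THE p. orthonormal p) k) = k" for k
    using orthonormal_THE by (simp add: orthonormal_def)
  then show ?thesis unfolding kernel_poly_def by (intro degree_sum_le) (auto intro: order.trans[OF degree_smult_le])
qed

lemma kernel_reproduces:
  assumes "degree f \<le> n"
  shows "(\<integral>y. poly (kernel_poly n x) y * poly f y \<partial>M) = poly f x"
proof -
  define p where "p = (THE p. orthonormal p)"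
  have p: "orthonormal p" unfolding p_def by (rule orthonormal_THE)
  obtain c where f: "f = (\<Sum>k<Suc n. smult (c k) (p k))"
    using orthonormal_expansion[OF p, of "Suc n" f] assms by (auto simp: coeff_eq_0)
  have 1: "ip (p k) f = c k" if "k \<le> n" for k
  proof -
    have "ip (p k) f = (\<Sum>j<Suc n. if j = k then c k else 0)"
      unfolding f ip_sum_right using p by (intro sum.cong) (auto simp: orthonormal_def)
    then show ?thesis using that by simp
  qed
  have "ip (kernel_poly n x) f = (\<Sum>k\<le>n. poly (p k) x * c k)"
    unfolding kernel_poly_def p_def[symmetric] by (simp add: ip_sum_left 1)
  also have "\<dots> = poly f x"
    unfolding f by (simp add: poly_sum lessThan_Suc_atMost mult.commute)
  finally show ?thesis by (simp add: ip_def)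
qed

text \<open>By Fubini, the one-variable reproducing property can be applied to each variable in turn, to the
  slices of \<open>g\<close>.\<close>

lemma kernel_product_reproduces:
  fixes g :: "real \<Rightarrow> real \<Rightarrow> real"
  assumes cont: "continuous_on UNIV (\<lambda>p. g (fst p) (snd p))"
    and left: "\<And>y2. \<exists>f. degree f \<le> n \<and> (\<forall>y1. g y1 y2 = poly f y1)"
    and right: "\<And>y1. \<exists>f. degree f \<le> n \<and> (\<forall>y2. g y1 y2 = poly f y2)"
  shows "(\<integral>p. poly (kernel_poly n x1) (fst p) * poly (kernel_poly n x2) (snd p) * g (fst p) (snd p) \<partial>(M \<Otimes>\<^sub>M M))
    = g x1 x2"
proof -
  have "(\<integral>p. poly (kernel_poly n x1) (fst p) * poly (kernel_poly n x2) (snd p) * g (fst p) (snd p) \<partial>(M \<Otimes>\<^sub>M M))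
    = (\<integral>y1. (\<integral>y2. poly (kernel_poly n x1) y1 * poly (kernel_poly n x2) y2 * g y1 y2 \<partial>M) \<partial>M)"
    by (subst integral_fst'[symmetric])
      (auto intro!: square_integrable_continuous continuous_intros cont)
  also have "\<dots> = (\<integral>y1. poly (kernel_poly n x1) y1 * g y1 x2 \<partial>M)"
  proof (rule Bochner_Integration.integral_cong)
    fix y1
    obtain f where "degree f \<le> n" "\<And>y2. g y1 y2 = poly f y2" using right by metis
    then show "(\<integral>y2. poly (kernel_poly n x1) y1 * poly (kernel_poly n x2) y2 * g y1 y2 \<partial>M) =
        poly (kernel_poly n x1) y1 * g y1 x2"
      using kernel_reproduces[of f n x2] by (simp add: mult.assoc)
  qed simp
  also have "\<dots> = g x1 x2"
  proof -
    obtain f where "degree f \<le> n" "\<And>y1. g y1 x2 = poly f y1" using left by metis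
    then show ?thesis using kernel_reproduces[of f n x1] by simp
  qed
  finally show ?thesis .
qed

end

section \<open>The weights on Omega as images of product measures\<close>

lemma lebesgue_integral_eq_lborel:
  fixes f g :: "'a::euclidean_space \<Rightarrow> real"
  assumes g: "g \<in> borel_measurable borel" and eq: "AE x in lborel. f x = g x"
  shows "integral\<^sup>L lebesgue f = integral\<^sup>L lborel g"
proof -
  have g': "g \<in> borel_measurable lebesgue" using g by (simp add: measurable_completion)
  have eq': "AE x in lebesgue. f x = g x" using eq by (rule AE_completion)
  have "f \<in> borel_measurable lebesgue"
    by (rule borel_measurable_AE[OF g']) (use eq' in \<open>auto simp: eq_commute\<close>)
  then have "integral\<^sup>L lebesgue f = integral\<^sup>L lebesgue g"
    using g' eq' by (rule integral_cong_AE)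
  also have "\<dots> = integral\<^sup>L lborel g" using g by (simp add: integral_completion)
  finally show ?thesis .
qed

lemma AE_lborel_both_coordinates:
  fixes P :: "real \<Rightarrow> bool"
  assumes "AE x in lborel. P x"
  shows "AE p in lborel. P (fst p) \<and> P (snd p)"
proof -
  obtain N where N: "{x. \<not> P x} \<subseteq> N" "N \<in> null_sets lborel"
    using assms by (auto simp: eventually_ae_filter)
  then have m: "N \<in> sets lborel" "emeasure lborel N = 0" by (auto simp: null_sets_def)
  have "N \<times> UNIV \<in> null_sets (lborel \<Otimes>\<^sub>M lborel)" "UNIV \<times> N \<in> null_sets (lborel \<Otimes>\<^sub>M lborel)"
    using m by (auto simp: null_sets_def lborel.emeasure_pair_measure_Times intro!: pair_measureI)
  then have "N \<times> UNIV \<union> UNIV \<times> N \<in> null_sets (lborel :: (real \<times> real) measure)"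
    unfolding lborel_prod by (rule null_sets.Un)
  then show ?thesis
    by (rule AE_I') (use N in auto)
qed

definition lower_root :: "real \<times> real \<Rightarrow> real" where
  "lower_root p = (fst p - sqrt ((fst p)\<^sup>2 - 4 * snd p)) / 2"

definition upper_root :: "real \<times> real \<Rightarrow> real" where
  "upper_root p = (fst p + sqrt ((fst p)\<^sup>2 - 4 * snd p)) / 2"

lemma root_measurable [measurable]:
  "lower_root \<in> borel_measurable borel" "upper_root \<in> borel_measurable borel"
  unfolding lower_root_def[abs_def] upper_root_def[abs_def]
  by (intro borel_measurable_continuous_onI continuous_intros; simp)+

lemma discriminant_vieta: "(fst (vieta (x, y)))\<^sup>2 - 4 * snd (vieta (x, y)) = (y - x)\<^sup>2"
  by (simp add: vieta_def power2_eq_square algebra_simps)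

lemma roots_vieta:
  assumes "x \<le> y"
  shows "lower_root (vieta (x, y)) = x" "upper_root (vieta (x, y)) = y"
  using assms unfolding lower_root_def upper_root_def discriminant_vieta
  by (auto simp: vieta_def)

text \<open>A null set \<open>N\<close> of arguments of \<open>w\<close> gives a null set of points of \<open>Omega\<close>: by the change of
  variables its measure is an integral over those pairs \<open>(x, y)\<close> that have a coordinate in \<open>N\<close>.
  This allows replacing \<open>w\<close> inside the two-variable weight by a function equal to it almost
  everywhere.\<close>

lemma AE_Omega_roots:
  assumes P: "AE x in lborel. P x"
  shows "AE v in lborel. v \<in> Omega \<longrightarrow> P (lower_root v) \<and> P (upper_root v)"
proof -
  obtain N where N: "{x. \<not> P x} \<subseteq> N" "N \<in> null_sets lborel"
    using assms by (auto simp: eventually_ae_filter)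
  have [measurable]: "N \<in> sets borel" using N by auto
  have "AE x in lborel. x \<notin> N" using N(2) by (rule AE_not_in)
  from AE_lborel_both_coordinates[OF this]
  have 1: "AE p in lborel. indicator Omega (vieta p) * ennreal (snd p - fst p) > 0 \<longrightarrow>
      lower_root (vieta p) \<notin> N \<and> upper_root (vieta p) \<notin> N"
  proof eventually_elim
    case (elim p)
    show ?case
    proof
      assume "indicator Omega (vieta p) * ennreal (snd p - fst p) > 0"
      then have "fst p < snd p" by (cases "fst p < snd p") (auto simp: ennreal_neg)
      then show "lower_root (vieta p) \<notin> N \<and> upper_root (vieta p) \<notin> N"
        using elim roots_vieta[of "fst p" "snd p"] by simp
    qed
  qed
  have "AE v in density lborel (indicator Omega). lower_root v \<notin> N \<and> upper_root v \<notin> N"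
    unfolding distr_vieta
  proof (subst AE_distr_iff)
    show "{v \<in> space borel. lower_root v \<notin> N \<and> upper_root v \<notin> N} \<in> sets borel" by measurable
    show "AE p in density lborel (\<lambda>p. indicator Omega (vieta p) * ennreal (snd p - fst p)).
        lower_root (vieta p) \<notin> N \<and> upper_root (vieta p) \<notin> N"
      using 1 by (subst AE_density[OF vieta_density_measurable]) simp
  qed simp
  then have "AE v in lborel. 0 < (indicator Omega v :: ennreal) \<longrightarrow> lower_root v \<notin> N \<and> upper_root v \<notin> N"
    by (subst (asm) AE_density) simp_all
  then show ?thesis
    by eventually_elim (use N(1) in \<open>auto simp: indicator_def\<close>)
qed

lemma integral_Omega_vieta:
  fixes g :: "real \<times> real \<Rightarrow> real"
  assumes g [measurable]: "g \<in> borel_measurable borel"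
  shows "(\<integral>v. indicator Omega v * g v \<partial>lborel) =
         (\<integral>p. indicator Omega (vieta p) * max 0 (snd p - fst p) * g (vieta p) \<partial>lborel)"
proof -
  have [measurable]: "(\<lambda>p :: real \<times> real. max 0 (snd p - fst p)) \<in> borel_measurable borel"
    by (intro borel_measurable_continuous_onI continuous_intros)
  have "(\<integral>v. indicator Omega v * g v \<partial>lborel) = (\<integral>v. g v \<partial>density lborel (indicator Omega))"
    using integral_density[of g lborel "indicator Omega"] by (simp add: ennreal_indicator)
  also have "\<dots> = (\<integral>p. g (vieta p) \<partial>density lborel (\<lambda>p. indicator Omega (vieta p) * ennreal (snd p - fst p)))"
    unfolding distr_vieta by (rule integral_distr) simp_all
  also have "(\<lambda>p. indicator Omega (vieta p) * ennreal (snd p - fst p)) =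
      (\<lambda>p. ennreal (indicator Omega (vieta p) * max 0 (snd p - fst p)))"
    by (auto simp: fun_eq_iff indicator_def max_def ennreal_neg)
  also have "(\<integral>p. g (vieta p) \<partial>density lborel \<dots>) =
      (\<integral>p. indicator Omega (vieta p) * max 0 (snd p - fst p) * g (vieta p) \<partial>lborel)"
    by (subst integral_density) auto
  finally show ?thesis .
qed

text \<open>The Borel representative \<open>h\<close> of the weight is made to vanish at the end points as well. Then
  integrals over the closed interval become integrals over the whole line, and the half plane
  \<open>x < y\<close> takes the place of the triangle \<open>-1 < x < y < 1\<close>.\<close>

locale weight_density =
  fixes w h :: "real \<Rightarrow> real"
  assumes weight: "weight_function w"
    and h_measurable [measurable]: "h \<in> borel_measurable borel"
    and h_nonneg: "\<And>x. 0 \<le> h x"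
    and h_support: "\<And>x. \<not> (- 1 < x \<and> x < 1) \<Longrightarrow> h x = 0"
    and w_eq_h: "AE x in lborel. indicator {-1..1} x * w x = h x"
begin

definition M :: "real measure" where
  "M = density lborel (\<lambda>x. ennreal (h x))"

lemma integral_weight:
  assumes f [measurable]: "f \<in> borel_measurable borel"
  shows "(LINT x:{-1..1}|lebesgue. f x * w x) = (\<integral>x. f x \<partial>M)"
proof -
  have "(LINT x:{-1..1}|lebesgue. f x * w x) = (\<integral>x. h x * f x \<partial>lborel)"
    unfolding set_lebesgue_integral_def
  proof (rule lebesgue_integral_eq_lborel)
    show "AE x in lborel. indicat_real {-1..1} x *\<^sub>R (f x * w x) = h x * f x"
      using w_eq_h by eventually_elim (metis mult.assoc mult.commute real_scaleR_def)
  qed simp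
  also have "\<dots> = (\<integral>x. f x \<partial>M)"
    unfolding M_def by (subst integral_density) (auto simp: h_nonneg)
  finally show ?thesis .
qed

sublocale atomless_measure M
proof (intro atomless_measure.intro atomless_measure_axioms.intro)
  show sets: "sets M = sets borel" by (simp add: M_def)
  have "set_integrable lebesgue {-1..1} (\<lambda>x. x ^ 0 * w x)"
    using weight unfolding weight_function_def by blast
  then have "(\<integral>\<^sup>+x. ennreal \<bar>indicator {-1..1} x * w x\<bar> \<partial>lebesgue) < \<infinity>"
    by (simp add: set_integrable_def integrable_iff_bounded)
  also have "(\<integral>\<^sup>+x. ennreal \<bar>indicator {-1..1} x * w x\<bar> \<partial>lebesgue) = (\<integral>\<^sup>+x. ennreal (h x) \<partial>lborel)"
    unfolding nn_integral_completion
    by (rule nn_integral_cong_AE) (use w_eq_h h_nonneg in \<open>auto elim!: eventually_mono\<close>)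
  also have "\<dots> = emeasure M UNIV" by (simp add: M_def emeasure_density)
  finally show "finite_measure M" by (intro finite_measureI) (simp add: M_def)
  show "AE x in M. - 1 < x \<and> x < 1"
    unfolding M_def by (subst AE_density) (auto intro!: AE_I2, (metis h_support less_irrefl)+)
  show "AE x in M. x \<noteq> a" for a
    unfolding M_def by (subst AE_density) (use AE_lborel_singleton[of a] in auto)
  show "\<not> (AE x in M. False)"
  proof
    assume F: "AE x in M. False"
    have "(\<integral>x. (1 :: real) \<partial>M) = (\<integral>x. 0 \<partial>M)"
      by (rule integral_cong_AE) (use F in auto)
    moreover have "0 < (LINT x:{-1..1}|lebesgue. w x)"
      using weight unfolding weight_function_def by blast
    ultimately show False using integral_weight[of "\<lambda>_. 1"] by simp
  qed
qed

lemma square_eq_density: "M \<Otimes>\<^sub>M M = density lborel (\<lambda>p. ennreal (h (fst p) * h (snd p)))"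
proof -
  have "M \<Otimes>\<^sub>M M = density (lborel \<Otimes>\<^sub>M lborel) (\<lambda>(x, y). ennreal (h x) * ennreal (h y))"
    unfolding M_def
  proof (rule pair_measure_density)
    have "sigma_finite_measure M" by unfold_locales
    then show "sigma_finite_measure (density lborel (\<lambda>x. ennreal (h x)))"
      by (simp only: M_def)
  qed (auto intro: lborel.sigma_finite_measure_axioms)
  then show ?thesis
    by (simp add: lborel_prod case_prod_unfold ennreal_mult h_nonneg)
qed

lemma density_measurable: "(\<lambda>p. h (fst p) * h (snd p)) \<in> borel_measurable borel"
proof -
  have "(\<lambda>p. h (fst p) * h (snd p)) \<in> borel_measurable (borel \<Otimes>\<^sub>M borel)" by measurable
  then show ?thesis by (simp add: borel_prod)
qed

lemma integral_square:
  assumes f: "f \<in> borel_measurable borel"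
  shows "(\<integral>p. f p \<partial>(M \<Otimes>\<^sub>M M)) = (\<integral>p. h (fst p) * h (snd p) * f p \<partial>lborel)"
  unfolding square_eq_density using f density_measurable
  by (subst integral_density) (auto simp: h_nonneg)

text \<open>For \<open>m = 2 \<gamma> + 1\<close> this is, up to normalization, the density of the two-variable weight on the
  square with respect to the product measure.\<close>

definition gap :: "nat \<Rightarrow> real \<times> real \<Rightarrow> real" where
  "gap m p = \<bar>fst p - snd p\<bar> ^ m"

lemma gap_continuous: "continuous_on UNIV (gap m)"
  unfolding gap_def[abs_def] by (intro continuous_intros)

text \<open>The diagonal has to be excluded for \<open>m = 0\<close>, where \<open>0 powr 0 = 0\<close> but \<open>0 ^ 0 = 1\<close>.\<close>

lemma norm_const_eq: "norm_const w ((real m - 1) / 2) = 1 / (\<integral>p. gap m p \<partial>(M \<Otimes>\<^sub>M M))"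
proof -
  have off: "AE p in lborel. fst p \<noteq> (snd p :: real)"
    using AE_off_diagonal[OF lborel_pair.pair_sigma_finite_axioms _ _ AE_lborel_singleton]
    unfolding lborel_prod by simp
  have "set_lebesgue_integral lebesgue ({-1..1} \<times> {-1..1})
      (\<lambda>(x, y). w x * w y * \<bar>x - y\<bar> powr (2 * ((real m - 1) / 2) + 1)) =
      (\<integral>p. h (fst p) * h (snd p) * gap m p \<partial>lborel)"
    unfolding set_lebesgue_integral_def
  proof (rule lebesgue_integral_eq_lborel)
    show "(\<lambda>p. h (fst p) * h (snd p) * gap m p) \<in> borel_measurable borel"
      by (intro borel_measurable_times density_measurable borel_measurable_continuous_onI gap_continuous)
    show "AE p in lborel. indicat_real ({-1..1} \<times> {-1..1}) p *\<^sub>R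
        (case p of (x, y) \<Rightarrow> w x * w y * \<bar>x - y\<bar> powr (2 * ((real m - 1) / 2) + 1)) =
        h (fst p) * h (snd p) * gap m p"
      using AE_lborel_both_coordinates[OF w_eq_h] off
    proof eventually_elim
      case (elim p)
      have exponent: "2 * ((real m - 1) / 2) + 1 = real m" by (simp add: field_simps)
      have "indicat_real ({-1..1} \<times> {-1..1}) p *\<^sub>R
        (case p of (x, y) \<Rightarrow> w x * w y * \<bar>x - y\<bar> powr (2 * ((real m - 1) / 2) + 1)) =
        (indicator {-1..1} (fst p) * w (fst p)) * (indicator {-1..1} (snd p) * w (snd p)) *
        \<bar>fst p - snd p\<bar> powr real m"
        unfolding exponent by (cases p) (simp add: indicator_times)
      also have "\<dots> = h (fst p) * h (snd p) * gap m p"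
        using elim by (simp add: gap_def powr_realpow)
      finally show ?case .
    qed
  qed
  also have "\<dots> = (\<integral>p. gap m p \<partial>(M \<Otimes>\<^sub>M M))"
    by (rule integral_square[symmetric]) (intro borel_measurable_continuous_onI gap_continuous)
  finally show ?thesis by (simp add: norm_const_def)
qed

text \<open>The integrand vanishes at most on the diagonal, which is a null set, while the product measure is
  not zero.\<close>

lemma gap_integral_pos: "0 < (\<integral>p. gap m p \<partial>(M \<Otimes>\<^sub>M M))"
proof (rule ccontr)
  assume "\<not> ?thesis"
  moreover have "0 \<le> (\<integral>p. gap m p \<partial>(M \<Otimes>\<^sub>M M))" by (simp add: gap_def)
  ultimately have "(\<integral>p. gap m p \<partial>(M \<Otimes>\<^sub>M M)) = 0" by simp
  then have "AE p in M \<Otimes>\<^sub>M M. gap m p = 0"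
    by (subst (asm) integral_nonneg_eq_0_iff_AE[OF square_integrable_continuous[OF gap_continuous]])
      (auto simp: gap_def)
  with square_off_diagonal have "AE p in M \<Otimes>\<^sub>M M. False"
    by eventually_elim (auto simp: gap_def)
  then have "AE x in M. AE y in M. False" by (rule AE_pair)
  with nontrivial show False by simp
qed

lemma norm_const_pos: "0 < norm_const w ((real m - 1) / 2)"
  unfolding norm_const_eq using gap_integral_pos by simp

text \<open>At \<open>(x + y, x y)\<close> the discriminant \<open>u\<^sup>2 - 4 v\<close> is \<open>(y - x)\<^sup>2\<close>, so the factor
  \<open>(u\<^sup>2 - 4 v) powr \<gamma>\<close> times the Jacobian is \<open>(y - x)\<close> to the power \<open>2 \<gamma> + 1 = m\<close>.\<close>

lemma W_vieta_Jacobian: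
  assumes "x < y"
  shows "(y - x) * (2 * c * h x * h y * ((fst (vieta (x, y)))\<^sup>2 - 4 * snd (vieta (x, y))) powr ((real m - 1) / 2)) =
    2 * c * (h x * h y * gap m (x, y))"
proof -
  have "((y - x)\<^sup>2) powr ((real m - 1) / 2) = (y - x) powr (real m - 1)"
    using assms by (simp add: powr_powr diff_divide_distrib flip: powr_numeral)
  then have "(y - x) * ((y - x)\<^sup>2) powr ((real m - 1) / 2) = gap m (x, y)"
    using assms by (simp add: gap_def powr_diff powr_realpow abs_minus_commute)
  then show ?thesis unfolding discriminant_vieta by (simp add: mult_ac)
qed

text \<open>The factor \<open>2\<close> in the weight compensates for integrating over only one of the two triangles into
  which the diagonal divides the square. This identity turns every statement about \<open>W\<close> into one about
  the product measure.\<close>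

lemma integral_Omega_W:
  assumes f: "continuous_on UNIV f"
  shows "(LINT v:Omega|lebesgue. f v * W w ((real m - 1) / 2) v) =
    norm_const w ((real m - 1) / 2) * (\<integral>p. f (vieta p) * gap m p \<partial>(M \<Otimes>\<^sub>M M))"
proof -
  define \<gamma> where "\<gamma> = (real m - 1) / 2"
  define c where "c = norm_const w \<gamma>"
  define V where "V v = 2 * c * h (lower_root v) * h (upper_root v) * ((fst v)\<^sup>2 - 4 * snd v) powr \<gamma>" for v
  have [measurable]: "f \<in> borel_measurable borel" using f by (rule borel_measurable_continuous_onI)
  have [measurable]: "(\<lambda>v :: real \<times> real. (fst v)\<^sup>2 - 4 * snd v) \<in> borel_measurable borel"
    by (intro borel_measurable_continuous_onI continuous_intros)
  have [measurable]: "V \<in> borel_measurable borel" unfolding V_def[abs_def] by measurable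
  have vieta_cont: "continuous_on UNIV vieta"
    unfolding vieta_def case_prod_unfold by (intro continuous_intros)
  have cont: "continuous_on UNIV (\<lambda>p. f (vieta p) * gap m p)"
    by (intro continuous_intros gap_continuous continuous_on_compose2[OF f vieta_cont]) auto
  have half: "(\<lambda>p. indicator {p. fst p < snd p} p * (f (vieta p) * gap m p)) \<in> borel_measurable borel"
    by (intro borel_measurable_times borel_measurable_indicator borel_measurable_continuous_onI[OF cont]
        borel_open open_Collect_less continuous_intros)
  have "(LINT v:Omega|lebesgue. f v * W w \<gamma> v) = (\<integral>v. indicator Omega v * (f v * V v) \<partial>lborel)"
    unfolding set_lebesgue_integral_def
  proof (rule lebesgue_integral_eq_lborel)
    show "AE v in lborel. indicat_real Omega v *\<^sub>R (f v * W w \<gamma> v) = indicator Omega v * (f v * V v)"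
      using AE_Omega_roots[OF w_eq_h]
    proof eventually_elim
      case (elim v)
      show ?case
      proof (cases "v \<in> Omega")
        case True
        then have "v \<in> (\<lambda>(x, y). (x + y, x * y)) ` {(x, y). -1 < x \<and> x < y \<and> y < 1}"
          using Omega_bij by (simp add: bij_betw_def)
        then obtain x y where xy: "v = vieta (x, y)" "-1 < x" "x < y" "y < 1"
          by (auto simp: vieta_def)
        then have roots: "lower_root v = x" "upper_root v = y" using roots_vieta[of x y] by auto
        then have "w x = h x" "w y = h y" using elim True xy by auto
        then have "W w \<gamma> v = V v"
          using roots by (auto simp: W_def V_def Let_def case_prod_unfold c_def lower_root_def upper_root_def)
        then show ?thesis by simp
      qed simp
    qed
  qed measurable
  also have "\<dots> = (\<integral>p. indicator Omega (vieta p) * max 0 (snd p - fst p) * (f (vieta p) * V (vieta p)) \<partial>lborel)"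
    by (rule integral_Omega_vieta) measurable
  also have "\<dots> = (\<integral>p. 2 * c * (h (fst p) * h (snd p) *
      (indicator {p. fst p < snd p} p * (f (vieta p) * gap m p))) \<partial>lborel)"
  proof (rule Bochner_Integration.integral_cong)
    fix p :: "real \<times> real"
    obtain x y where p: "p = (x, y)" by (cases p)
    show "indicator Omega (vieta p) * max 0 (snd p - fst p) * (f (vieta p) * V (vieta p)) =
      2 * c * (h (fst p) * h (snd p) * (indicator {p. fst p < snd p} p * (f (vieta p) * gap m p)))"
    proof (cases "x < y")
      case True
      have "(y - x) * V (vieta (x, y)) = 2 * c * (h x * h y * gap m (x, y))"
        using W_vieta_Jacobian[OF True] True unfolding V_def \<gamma>_def by (simp add: roots_vieta)
      moreover have "h x * h y = 0" if "vieta (x, y) \<notin> Omega"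
        using that h_support[of x] h_support[of y] vieta_mem_Omega_iff[of x y] True by auto
      ultimately show ?thesis using True
        by (cases "vieta (x, y) \<in> Omega") (auto simp: p)
    qed (simp add: p)
  qed simp
  also have "\<dots> = 2 * c * (\<integral>p. indicator {p. fst p < snd p} p * (f (vieta p) * gap m p) \<partial>(M \<Otimes>\<^sub>M M))"
    by (simp add: integral_square[OF half])
  also have "\<dots> = c * (\<integral>p. f (vieta p) * gap m p \<partial>(M \<Otimes>\<^sub>M M))"
    by (subst integral_symmetric_half[OF cont])
      (auto simp: vieta_def gap_def abs_minus_commute add.commute mult.commute)
  finally show ?thesis by (simp add: c_def \<gamma>_def)
qed

end

text \<open>A Borel function equal to \<open>w\<close> almost everywhere, cut off at zero and at the end points of the
  interval; both changes concern null sets only.\<close>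

lemma ex_weight_density:
  assumes "weight_function w"
  shows "\<exists>h. weight_density w h"
proof -
  have "set_integrable lebesgue {-1..1} (\<lambda>x. x ^ 0 * w x)"
    using assms unfolding weight_function_def by blast
  then have "(\<lambda>x. indicator {-1..1} x * w x) \<in> borel_measurable lebesgue"
    by (auto simp: set_integrable_def dest: borel_measurable_integrable)
  then obtain g where g [measurable]: "g \<in> borel_measurable borel"
    and eq: "AE x in lborel. indicator {-1..1} x * w x = g x"
    using completion_ex_borel_measurable_real by fastforce
  have "weight_density w (\<lambda>x. indicator {-1<..<1} x * max 0 (g x))"
  proof
    show "AE x in lborel. indicator {-1..1} x * w x = indicator {-1<..<1} x * max 0 (g x)"
      using eq AE_lborel_singleton[of "-1 :: real"] AE_lborel_singleton[of "1 :: real"]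
    proof eventually_elim
      case (elim x)
      have nonneg: "\<forall>x\<in>{-1..1}. 0 \<le> w x"
        using assms unfolding weight_function_def by blast
      show ?case
      proof (cases "x \<in> {-1..1}")
        case True
        then have "w x = g x" "-1 < x" "x < 1" using elim by auto
        moreover have "0 \<le> w x" using nonneg True by blast
        ultimately show ?thesis using True by simp
      qed auto
    qed
  qed (use assms in auto)
  then show ?thesis by blast
qed

section \<open>The kernels of the two weights\<close>

context weight_density
begin

lemma orthonormal_polys_eq: "orthonormal_polys w = (THE p. orthonormal p)"
proof -
  have "(LINT x:{-1..1}|lebesgue. poly q x * poly r x * w x) = ip q r" for q r
    unfolding ip_def
    by (rule integral_weight) (intro borel_measurable_continuous_onI continuous_intros)
  then show ?thesis unfolding orthonormal_polys_def orthonormal_def by simp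
qed

lemma kernel1_eq: "kernel1 w n x y = poly (kernel_poly n x) y"
  by (simp add: kernel1_def kernel_poly_def poly_sum orthonormal_polys_eq)

text \<open>The inner product of \<open>L\<^sup>2(W)\<close> transported to the square. There the integrands are continuous, hence
  integrable, which makes additivity immediate.\<close>

definition pairing :: "nat \<Rightarrow> (real \<times> real \<Rightarrow> real) \<Rightarrow> (real \<times> real \<Rightarrow> real) \<Rightarrow> real" where
  "pairing m q f =
     norm_const w ((real m - 1) / 2) * (\<integral>p. q (vieta p) * f (vieta p) * gap m p \<partial>(M \<Otimes>\<^sub>M M))"

lemma continuous_on_Pi2_vieta:
  assumes "f \<in> Pi2 n"
  shows "continuous_on UNIV (\<lambda>p. f (vieta p))"
proof (rule continuous_on_compose2[OF Pi2_continuous[OF assms, of UNIV]])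
  show "continuous_on UNIV vieta"
    unfolding vieta_def case_prod_unfold by (intro continuous_intros)
qed simp

lemma integral_Omega_W_Pi2:
  assumes "q \<in> Pi2 n" "f \<in> Pi2 n"
  shows "(LINT v:Omega|lebesgue. q v * f v * W w ((real m - 1) / 2) v) = pairing m q f"
  unfolding pairing_def
  by (rule integral_Omega_W) (intro continuous_intros Pi2_continuous[OF assms(1)] Pi2_continuous[OF assms(2)])

lemma pairing_commute: "pairing m q f = pairing m f q"
  by (simp add: pairing_def mult.commute)

lemma pairing_diff_left:
  assumes "q \<in> Pi2 n" "r \<in> Pi2 n" "f \<in> Pi2 n"
  shows "pairing m (\<lambda>v. q v - r v) f = pairing m q f - pairing m r f"
proof -
  have "integrable (M \<Otimes>\<^sub>M M) (\<lambda>p. s (vieta p) * f (vieta p) * gap m p)" if "s \<in> Pi2 n" for s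
    by (intro square_integrable_continuous continuous_intros gap_continuous
        continuous_on_Pi2_vieta[OF that] continuous_on_Pi2_vieta[OF assms(3)])
  then show ?thesis
    using assms by (simp add: pairing_def left_diff_distrib right_diff_distrib)
qed

text \<open>If \<open>q\<close> and \<open>r\<close> both represent evaluation at \<open>u\<close>, and \<open>k\<close> represents evaluation at \<open>z\<close>, then
  \<open>(r - q) z\<close> is the pairing of \<open>r - q\<close> with \<open>k\<close>, which is \<open>k u - k u = 0\<close>. So existence of
  representers at all points of \<open>Omega\<close> implies their uniqueness as polynomials.\<close>

lemma kernel2_eqI:
  assumes ex: "\<And>z. z \<in> Omega \<Longrightarrow> \<exists>q\<in>Pi2 n. \<forall>f\<in>Pi2 n. pairing m q f = f z"
    and q: "q \<in> Pi2 n" "\<And>f. f \<in> Pi2 n \<Longrightarrow> pairing m q f = f u"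
  shows "kernel2 w ((real m - 1) / 2) n u = q"
  unfolding kernel2_def
proof (rule the_equality)
  show "q \<in> Pi2 n \<and> (\<forall>f\<in>Pi2 n. (LINT v:Omega|lebesgue. q v * f v * W w ((real m - 1) / 2) v) = f u)"
    using q by (simp add: integral_Omega_W_Pi2)
next
  fix r assume "r \<in> Pi2 n \<and> (\<forall>f\<in>Pi2 n. (LINT v:Omega|lebesgue. r v * f v * W w ((real m - 1) / 2) v) = f u)"
  then have r: "r \<in> Pi2 n" "\<And>f. f \<in> Pi2 n \<Longrightarrow> pairing m r f = f u"
    using integral_Omega_W_Pi2[of r n] by auto
  have d: "(\<lambda>v. r v - q v) \<in> Pi2 n" by (rule Pi2_diff[OF r(1) q(1)])
  have "r z - q z = 0" if z: "z \<in> Omega" for z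
  proof -
    obtain k where k: "k \<in> Pi2 n" "\<And>f. f \<in> Pi2 n \<Longrightarrow> pairing m k f = f z"
      using ex[OF z] by blast
    have "r z - q z = pairing m (\<lambda>v. r v - q v) k"
      using k(2)[OF d] by (simp add: pairing_commute)
    also have "\<dots> = 0"
      using r(2)[OF k(1)] q(2)[OF k(1)] pairing_diff_left[OF r(1) q(1) k(1)] by simp
    finally show ?thesis .
  qed
  moreover have "(0, -1/2) \<in> Omega" by (simp add: Omega_def)
  ultimately have "r z - q z = 0" for z
    using Pi2_eq_zero_if_zero_on_open[OF d open_Omega] by blast
  then show "r = q" by auto
qed

lemma kernel_product_reproduces_Pi2:
  assumes "f \<in> Pi2 n"
  shows "(\<integral>p. poly (kernel_poly n x1) (fst p) * poly (kernel_poly n x2) (snd p) * f (vieta p)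
      \<partial>(M \<Otimes>\<^sub>M M)) = f (vieta (x1, x2))"
proof -
  have slice: "\<exists>r. degree r \<le> n \<and> (\<forall>x. f (vieta (x, y)) = poly r x)" for y
  proof -
    have "degree [:y, 1:] \<le> 1" "degree [:0, y:] \<le> 1"
      by (rule order.trans[OF degree_pCons_le], simp)+
    from Pi2_poly_substitution[OF assms this] show ?thesis
      by (simp add: vieta_def add.commute)
  qed
  have "vieta (x, y) = vieta (y, x)" for x y by (simp add: vieta_def add.commute mult.commute)
  then have slice': "\<exists>r. degree r \<le> n \<and> (\<forall>x. f (vieta (y, x)) = poly r x)" for y
    using slice[of y] by metis
  show ?thesis
    using kernel_product_reproduces[of "\<lambda>x y. f (vieta (x, y))" n x1 x2] slice slice'
      continuous_on_Pi2_vieta[OF assms] by simp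
qed

text \<open>The factor \<open>x - y\<close> raises the degree of each slice by one, which is why the kernel of degree
  \<open>n + 1\<close> appears.\<close>

lemma kernel_product_reproduces_antisymmetric:
  assumes "f \<in> Pi2 n"
  shows "(\<integral>p. poly (kernel_poly (Suc n) x1) (fst p) * poly (kernel_poly (Suc n) x2) (snd p) *
      ((fst p - snd p) * f (vieta p)) \<partial>(M \<Otimes>\<^sub>M M)) =
    (x1 - x2) * f (vieta (x1, x2))"
proof -
  have slice: "\<exists>r. degree r \<le> Suc n \<and> (\<forall>x. (x - y) * f (vieta (x, y)) = poly r x)" for y
  proof -
    have "degree [:y, 1:] \<le> 1" "degree [:0, y:] \<le> 1"
      by (rule order.trans[OF degree_pCons_le], simp)+
    from Pi2_poly_substitution[OF assms this] obtain r
      where r: "degree r \<le> n" "\<And>x. f (vieta (x, y)) = poly r x"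
      by (auto simp: vieta_def add.commute)
    have "degree ([:- y, 1:] * r) \<le> Suc n"
      using degree_mult_le[of "[:- y, 1:]" r] r(1) by simp
    moreover have "(x - y) * f (vieta (x, y)) = poly ([:- y, 1:] * r) x" for x
      by (simp add: r algebra_simps)
    ultimately show ?thesis by blast
  qed
  have slice': "\<exists>r. degree r \<le> Suc n \<and> (\<forall>x. (y - x) * f (vieta (y, x)) = poly r x)" for y
  proof -
    obtain r where r: "degree r \<le> Suc n" "\<And>x. (x - y) * f (vieta (x, y)) = poly r x"
      using slice[of y] by blast
    have "(y - x) * f (vieta (y, x)) = poly (- r) x" for x
      using r(2)[of x] by (simp add: vieta_def add.commute mult.commute algebra_simps)
    then show ?thesis using r(1) by (intro exI[of _ "- r"]) simp
  qed
  show ?thesis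
    using kernel_product_reproduces[of "\<lambda>x y. (x - y) * f (vieta (x, y))" "Suc n" x1 x2] slice slice'
      continuous_on_Pi2_vieta[OF assms] by (simp add: continuous_intros)
qed

lemma integrable_kernel_product:
  "continuous_on UNIV g \<Longrightarrow>
    integrable (M \<Otimes>\<^sub>M M) (\<lambda>p. poly P (fst p) * poly Q (snd p) * g p)"
  by (intro square_integrable_continuous continuous_intros)

text \<open>The two terms of the symmetrized kernel reproduce \<open>f\<close> at \<open>(x1, x2)\<close> and at \<open>(x2, x1)\<close>; the values
  agree by symmetry, whence the factor \<open>1/2\<close>.\<close>

lemma symmetric_representer:
  "\<exists>q\<in>Pi2 n.
     (\<forall>y1 y2. q (vieta (y1, y2)) = 1 / norm_const w ((real 0 - 1) / 2) *
        (1 / 2 * (kernel1 w n x1 y1 * kernel1 w n x2 y2 + kernel1 w n x2 y1 * kernel1 w n x1 y2))) \<and>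
     (\<forall>f\<in>Pi2 n. pairing 0 q f = f (vieta (x1, x2)))"
proof -
  define c where "c = norm_const w ((real 0 - 1) / 2)"
  have c: "0 < c" unfolding c_def by (rule norm_const_pos)
  let ?A = "kernel_poly n x1" and ?B = "kernel_poly n x2"
  obtain q0 where q0: "q0 \<in> Pi2 n"
    "\<And>x y. q0 (x + y, x * y) = poly ?A x * poly ?B y + poly ?B x * poly ?A y"
    using symmetric_product_Pi2[OF degree_kernel_poly degree_kernel_poly] by blast
  define q where "q = (\<lambda>z. 1 / (2 * c) * q0 z)"
  have q: "q \<in> Pi2 n" unfolding q_def by (rule Pi2_scale[OF q0(1)])
  have qv: "q (vieta p) =
      1 / (2 * c) * (poly ?A (fst p) * poly ?B (snd p) + poly ?B (fst p) * poly ?A (snd p))" for p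
    by (simp add: q_def vieta_def case_prod_unfold q0)
  have "pairing 0 q f = f (vieta (x1, x2))" if f: "f \<in> Pi2 n" for f
  proof -
    let ?I = "\<lambda>P Q. \<integral>p. poly P (fst p) * poly Q (snd p) * f (vieta p) \<partial>(M \<Otimes>\<^sub>M M)"
    have int: "integrable (M \<Otimes>\<^sub>M M) (\<lambda>p. poly P (fst p) * poly Q (snd p) * f (vieta p))" for P Q
      by (rule integrable_kernel_product[OF continuous_on_Pi2_vieta[OF f]])
    have "pairing 0 q f = c * (\<integral>p. 1 / (2 * c) * (poly ?A (fst p) * poly ?B (snd p) * f (vieta p) +
        poly ?B (fst p) * poly ?A (snd p) * f (vieta p)) \<partial>(M \<Otimes>\<^sub>M M))"
      unfolding pairing_def c_def[symmetric] qv
      by (intro arg_cong[of _ _ "\<lambda>t. c * t"] Bochner_Integration.integral_cong) (simp_all add: gap_def algebra_simps)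
    also have "\<dots> = 1 / 2 * (?I ?A ?B + ?I ?B ?A)"
      using c int by simp
    also have "\<dots> = 1 / 2 * (f (vieta (x1, x2)) + f (vieta (x2, x1)))"
      by (simp only: kernel_product_reproduces_Pi2[OF f])
    also have "\<dots> = f (vieta (x1, x2))"
      by (simp add: vieta_def add.commute mult.commute)
    finally show ?thesis .
  qed
  moreover have "q (vieta (y1, y2)) = 1 / c *
      (1 / 2 * (kernel1 w n x1 y1 * kernel1 w n x2 y2 + kernel1 w n x2 y1 * kernel1 w n x1 y2))" for y1 y2
    by (simp add: qv kernel1_eq)
  ultimately show ?thesis using q unfolding c_def by blast
qed

text \<open>Of the factor \<open>(y1 - y2)\<^sup>2\<close> in the density, one \<open>y1 - y2\<close> cancels the denominator of the kernel
  and the other makes \<open>f\<close> antisymmetric. The two terms of the determinant then contribute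
  \<open>(x1 - x2) f\<close> each, which explains both \<open>1/2\<close> and the denominator \<open>x1 - x2\<close>.\<close>

lemma antisymmetric_representer:
  assumes "x1 \<noteq> x2"
  shows "\<exists>q\<in>Pi2 n.
     (\<forall>y1 y2. y1 \<noteq> y2 \<longrightarrow> q (vieta (y1, y2)) = 1 / norm_const w ((real 2 - 1) / 2) *
        (1 / 2 * ((kernel1 w (n + 1) x1 y1 * kernel1 w (n + 1) x2 y2
            - kernel1 w (n + 1) x2 y1 * kernel1 w (n + 1) x1 y2) / ((x1 - x2) * (y1 - y2))))) \<and>
     (\<forall>f\<in>Pi2 n. pairing 2 q f = f (vieta (x1, x2)))"
proof -
  define c where "c = norm_const w ((real 2 - 1) / 2)"
  have c: "0 < c" unfolding c_def by (rule norm_const_pos)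
  let ?A = "kernel_poly (Suc n) x1" and ?B = "kernel_poly (Suc n) x2"
  obtain q0 where q0: "q0 \<in> Pi2 n"
    "\<And>x y. (x - y) * q0 (x + y, x * y) = poly ?A x * poly ?B y - poly ?B x * poly ?A y"
    using antisymmetric_product_Pi2[OF degree_kernel_poly degree_kernel_poly] by blast
  define a where "a = 1 / (2 * c * (x1 - x2))"
  define q where "q = (\<lambda>z. a * q0 z)"
  have q: "q \<in> Pi2 n" unfolding q_def by (rule Pi2_scale[OF q0(1)])
  have qv: "(fst p - snd p) * q (vieta p) =
      a * (poly ?A (fst p) * poly ?B (snd p) - poly ?B (fst p) * poly ?A (snd p))" for p
    unfolding q0(2)[symmetric] by (simp add: q_def vieta_def case_prod_unfold)
  have "pairing 2 q f = f (vieta (x1, x2))" if f: "f \<in> Pi2 n" for f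
  proof -
    let ?g = "\<lambda>p. (fst p - snd p) * f (vieta p)"
    let ?I = "\<lambda>P Q. \<integral>p. poly P (fst p) * poly Q (snd p) * ?g p \<partial>(M \<Otimes>\<^sub>M M)"
    have int: "integrable (M \<Otimes>\<^sub>M M) (\<lambda>p. poly P (fst p) * poly Q (snd p) * ?g p)" for P Q
      by (intro integrable_kernel_product continuous_intros continuous_on_Pi2_vieta[OF f])
    have "pairing 2 q f = c * (\<integral>p. a * (poly ?A (fst p) * poly ?B (snd p) * ?g p -
        poly ?B (fst p) * poly ?A (snd p) * ?g p) \<partial>(M \<Otimes>\<^sub>M M))"
      unfolding pairing_def c_def[symmetric]
    proof (intro arg_cong[of _ _ "\<lambda>t. c * t"] Bochner_Integration.integral_cong)
      fix p :: "real \<times> real"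
      have "q (vieta p) * f (vieta p) * gap 2 p = ((fst p - snd p) * q (vieta p)) * ?g p"
        by (simp add: gap_def power2_eq_square)
      also have "\<dots> = a * (poly ?A (fst p) * poly ?B (snd p) * ?g p - poly ?B (fst p) * poly ?A (snd p) * ?g p)"
        unfolding qv by (simp add: algebra_simps)
      finally show "q (vieta p) * f (vieta p) * gap 2 p =
          a * (poly ?A (fst p) * poly ?B (snd p) * ?g p - poly ?B (fst p) * poly ?A (snd p) * ?g p)" .
    qed simp
    also have "\<dots> = c * a * (?I ?A ?B - ?I ?B ?A)"
      by (simp only: integral_mult_right_zero Bochner_Integration.integral_diff[OF int int] mult.assoc[of c a])
    also have "\<dots> = c * a * ((x1 - x2) * f (vieta (x1, x2)) - (x2 - x1) * f (vieta (x2, x1)))"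
      by (simp only: kernel_product_reproduces_antisymmetric[OF f])
    also have "vieta (x2, x1) = vieta (x1, x2)"
      by (simp add: vieta_def add.commute mult.commute)
    also have "c * a * ((x1 - x2) * f (vieta (x1, x2)) - (x2 - x1) * f (vieta (x1, x2))) = f (vieta (x1, x2))"
      using c assms by (simp add: a_def field_simps)
    finally show ?thesis .
  qed
  moreover have "q (vieta (y1, y2)) = 1 / c *
        (1 / 2 * ((kernel1 w (n + 1) x1 y1 * kernel1 w (n + 1) x2 y2
            - kernel1 w (n + 1) x2 y1 * kernel1 w (n + 1) x1 y2) / ((x1 - x2) * (y1 - y2))))"
    if "y1 \<noteq> y2" for y1 y2
  proof -
    let ?D = "poly ?A y1 * poly ?B y2 - poly ?B y1 * poly ?A y2"
    have "q (vieta (y1, y2)) = a * ?D / (y1 - y2)"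
      using qv[of "(y1, y2)"] that by (simp add: eq_divide_eq mult.commute)
    also have "\<dots> = 1 / c * (1 / 2 * (?D / ((x1 - x2) * (y1 - y2))))"
      by (simp add: a_def)
    finally show ?thesis by (simp add: kernel1_eq)
  qed
  ultimately show ?thesis using q unfolding c_def by blast
qed

end

lemma distinct_if_vieta_mem_Omega: "vieta (x, y) \<in> Omega \<Longrightarrow> x \<noteq> y"
  by (auto simp: Omega_def vieta_def power2_eq_square)

lemma Omega_vieta_cases:
  assumes "z \<in> Omega"
  obtains x y where "z = vieta (x, y)" "x \<noteq> y"
proof -
  have "z \<in> (\<lambda>(x, y). (x + y, x * y)) ` {(x, y). -1 < x \<and> x < y \<and> y < 1}"
    using Omega_bij assms by (simp add: bij_betw_def)
  then show ?thesis using that by (auto simp: vieta_def)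
qed

theorem theorem3p1:
  fixes w :: "real \<Rightarrow> real" and n :: nat and x1 x2 y1 y2 :: real and u v :: "real \<times> real"
  assumes "weight_function w"
    and "u = (x1 + x2, x1 * x2)" and "v = (y1 + y2, y1 * y2)"
    and "u \<in> Omega" and "v \<in> Omega"
  shows "kernel2 w (- 1 / 2) n u v =
           1 / norm_const w (- 1 / 2) *
           (1 / 2 * (kernel1 w n x1 y1 * kernel1 w n x2 y2 + kernel1 w n x2 y1 * kernel1 w n x1 y2)) \<and>
         kernel2 w (1 / 2) n u v =
           1 / norm_const w (1 / 2) *
           (1 / 2 * ((kernel1 w (n + 1) x1 y1 * kernel1 w (n + 1) x2 y2
                      - kernel1 w (n + 1) x2 y1 * kernel1 w (n + 1) x1 y2)
                     / ((x1 - x2) * (y1 - y2))))"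
proof -
  obtain h where "weight_density w h" using ex_weight_density[OF assms(1)] by blast
  then interpret weight_density w h .
  have u: "u = vieta (x1, x2)" and v: "v = vieta (y1, y2)"
    using assms by (simp_all add: vieta_def)
  have ne: "x1 \<noteq> x2" "y1 \<noteq> y2"
    using distinct_if_vieta_mem_Omega assms(4,5) unfolding u v by blast+
  show ?thesis
  proof
    have ex: "\<exists>q\<in>Pi2 n. \<forall>f\<in>Pi2 n. pairing 0 q f = f z" if "z \<in> Omega" for z
      using that symmetric_representer by (elim Omega_vieta_cases) blast
    obtain q where q: "q \<in> Pi2 n" "\<And>f. f \<in> Pi2 n \<Longrightarrow> pairing 0 q f = f u"
      "q v = 1 / norm_const w ((real 0 - 1) / 2) *
        (1 / 2 * (kernel1 w n x1 y1 * kernel1 w n x2 y2 + kernel1 w n x2 y1 * kernel1 w n x1 y2))"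
      using symmetric_representer[of n x1 x2] unfolding u v by blast
    show "kernel2 w (- 1 / 2) n u v = 1 / norm_const w (- 1 / 2) *
        (1 / 2 * (kernel1 w n x1 y1 * kernel1 w n x2 y2 + kernel1 w n x2 y1 * kernel1 w n x1 y2))"
      using kernel2_eqI[OF ex q(1,2)] q(3) by simp
  next
    have ex: "\<exists>q\<in>Pi2 n. \<forall>f\<in>Pi2 n. pairing 2 q f = f z" if "z \<in> Omega" for z
      using that antisymmetric_representer by (elim Omega_vieta_cases) blast
    obtain q where q: "q \<in> Pi2 n" "\<And>f. f \<in> Pi2 n \<Longrightarrow> pairing 2 q f = f u"
      "q v = 1 / norm_const w ((real 2 - 1) / 2) *
        (1 / 2 * ((kernel1 w (n + 1) x1 y1 * kernel1 w (n + 1) x2 y2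
            - kernel1 w (n + 1) x2 y1 * kernel1 w (n + 1) x1 y2) / ((x1 - x2) * (y1 - y2))))"
      using antisymmetric_representer[OF ne(1), of n] ne(2) unfolding u v by blast
    show "kernel2 w (1 / 2) n u v = 1 / norm_const w (1 / 2) *
        (1 / 2 * ((kernel1 w (n + 1) x1 y1 * kernel1 w (n + 1) x2 y2
            - kernel1 w (n + 1) x2 y1 * kernel1 w (n + 1) x1 y2) / ((x1 - x2) * (y1 - y2))))"
      using kernel2_eqI[OF ex q(1,2)] q(3) by simp
  qed
qed

end
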